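(* Let $T$ be a tree with $n$ vertices and constant maximum degree, and let the evolver be random. Run Algorithm 1 with speedup factor $c=2$ from an arbitrary initial hypothesis. Then there exists $z$ (a function of $n$) such that for all $j>z$, with high probability, $D(\mathcal{T},\mathcal{H})_j \in O(n)$.
   Context: Setting: $T=(V,E)$ is a fixed tree with $n$ vertices; labels $L=\{l_1,\dots,l_n\}$ are placed by a bijection $M_T:L\to V$. The random evolver, at each of its steps, picks an edge of $T$ uniformly at random and swaps the labels at its endpoints. The algorithm keeps a map $M_H:L\to V$ (not necessarily injective). An oracle $\mathcal{O}(l,u)$ returns null if $M_T(l)=u$ and otherwise the edge $(u,v)$ incident to $u$ on the tree path from $u$ to $M_T(l)$. Algorithm 1 repeats forever an iteration: for $i=1,\dots,n$, while $\mathcal{O}(l_i,M_H(l_i))\neq$ null, set $(u,v)\gets\mathcal{O}(l_i,M_H(l_i))$ and $M_H(l_i)\gets v$. With speedup $c$, the algorithm performs one oracle query per time unit and the evolver one swap every $c$ time units. The distance is $D(\mathcal{T},\mathcal{H})=\sum_{l\in L} d_T(M_T(l),M_H(l))$ with $d_T$ the tree path length, and $D(\mathcal{T},\mathcal{H})_j$ denotes its value at the start of the $j$-th iteration. *)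

theory Defs
  imports "HOL-Probability.Probability"
begin

section \<open>Finite trees\<close>

text \<open>A simple graph is a vertex set \<open>V\<close> together with a set \<open>E\<close> of two-element subsets of \<open>V\<close>.\<close>

definition simple_graph :: "'v set \<Rightarrow> 'v set set \<Rightarrow> bool" where
  "simple_graph V E \<longleftrightarrow>
     finite V \<and> (\<forall>e\<in>E. \<exists>u v. e = {u, v} \<and> u \<in> V \<and> v \<in> V \<and> u \<noteq> v)"

definition is_walk :: "'v set \<Rightarrow> 'v set set \<Rightarrow> 'v list \<Rightarrow> bool" where
  "is_walk V E p \<longleftrightarrow> p \<noteq> [] \<and> set p \<subseteq> V \<and> successively (\<lambda>u v. {u, v} \<in> E) p"

definition is_path :: "'v set \<Rightarrow> 'v set set \<Rightarrow> 'v \<Rightarrow> 'v list \<Rightarrow> 'v \<Rightarrow> bool" where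
  "is_path V E u p v \<longleftrightarrow> is_walk V E p \<and> distinct p \<and> hd p = u \<and> last p = v"

definition connected_graph :: "'v set \<Rightarrow> 'v set set \<Rightarrow> bool" where
  "connected_graph V E \<longleftrightarrow> V \<noteq> {} \<and> (\<forall>u\<in>V. \<forall>v\<in>V. \<exists>p. is_walk V E p \<and> hd p = u \<and> last p = v)"

definition is_cycle :: "'v set \<Rightarrow> 'v set set \<Rightarrow> 'v list \<Rightarrow> bool" where
  "is_cycle V E p \<longleftrightarrow> is_walk V E p \<and> distinct p \<and> length p \<ge> 3 \<and> {last p, hd p} \<in> E"

definition is_tree :: "'v set \<Rightarrow> 'v set set \<Rightarrow> bool" where
  "is_tree V E \<longleftrightarrow> simple_graph V E \<and> connected_graph V E \<and> (\<nexists>p. is_cycle V E p)"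

definition vertex_degree :: "'v set set \<Rightarrow> 'v \<Rightarrow> nat" where
  "vertex_degree E v = card {e \<in> E. v \<in> e}"

definition max_degree :: "'v set \<Rightarrow> 'v set set \<Rightarrow> nat" where
  "max_degree V E = Max (vertex_degree E ` V)"

definition tree_path :: "'v set \<Rightarrow> 'v set set \<Rightarrow> 'v \<Rightarrow> 'v \<Rightarrow> 'v list" where
  "tree_path V E u v = (THE p. is_path V E u p v)"

definition tree_dist :: "'v set \<Rightarrow> 'v set set \<Rightarrow> 'v \<Rightarrow> 'v \<Rightarrow> nat" where
  "tree_dist V E u v = length (tree_path V E u v) - 1"


section \<open>Labels, oracle and evolver\<close>

text \<open>
  The label \<open>l\<^sub>i\<close> is represented by its index \<open>i \<in> {1..n}\<close> with \<open>n = card V\<close>. Maps from labels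
  to vertices are functions on \<open>nat\<close> whose values outside \<open>{1..n}\<close> are irrelevant.
\<close>

definition labels :: "'v set \<Rightarrow> nat set" where
  "labels V = {1..card V}"

definition total_dist :: "'v set \<Rightarrow> 'v set set \<Rightarrow> (nat \<Rightarrow> 'v) \<Rightarrow> (nat \<Rightarrow> 'v) \<Rightarrow> nat" where
  "total_dist V E M\<^sub>T M\<^sub>H = (\<Sum>l\<in>labels V. tree_dist V E (M\<^sub>T l) (M\<^sub>H l))"

text \<open>The returned edge is the ordered pair \<open>(u, v)\<close>, \<open>v\<close> being the second vertex of the tree path.\<close>

definition oracle_query ::
  "'v set \<Rightarrow> 'v set set \<Rightarrow> (nat \<Rightarrow> 'v) \<Rightarrow> nat \<Rightarrow> 'v \<Rightarrow> ('v \<times> 'v) option" where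
  "oracle_query V E M\<^sub>T l u =
     (if M\<^sub>T l = u then None else Some (u, tree_path V E u (M\<^sub>T l) ! 1))"

text \<open>For \<open>M\<^sub>T l \<in> e\<close>, the new position of \<open>l\<close> is the other endpoint of \<open>e\<close>.\<close>

definition swap_labels :: "'v set \<Rightarrow> (nat \<Rightarrow> 'v) \<Rightarrow> (nat \<Rightarrow> 'v)" where
  "swap_labels e M\<^sub>T = (\<lambda>l. if M\<^sub>T l \<in> e then the_elem (e - {M\<^sub>T l}) else M\<^sub>T l)"

text \<open>The sequence of edges picked by the random evolver: independent and uniform on \<open>E\<close>.\<close>

definition evolver_space :: "'v set set \<Rightarrow> (nat \<Rightarrow> 'v set) measure" where
  "evolver_space E = Pi\<^sub>M UNIV (\<lambda>_. uniform_count_measure E)"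


section \<open>The tracking algorithm running against the evolver\<close>

record 'v state =
  truth :: "nat \<Rightarrow> 'v"     \<comment> \<open>\<open>M\<^sub>T\<close>\<close>
  hyp :: "nat \<Rightarrow> 'v"       \<comment> \<open>\<open>M\<^sub>H\<close>\<close>
  cur :: nat               \<comment> \<open>index of the label being processed\<close>
  iter :: nat              \<comment> \<open>number of the current iteration, starting with 1\<close>

definition init_state :: "(nat \<Rightarrow> 'v) \<Rightarrow> (nat \<Rightarrow> 'v) \<Rightarrow> 'v state" where
  "init_state M\<^sub>T M\<^sub>H = \<lparr>truth = M\<^sub>T, hyp = M\<^sub>H, cur = 1, iter = 1\<rparr>"

text \<open>
  One query of the algorithm. Its answer serves both as the test of the while loop and, if it is
  not null, as the edge used in the loop body. A null answer ends the loop for the current label;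
  for the last label it also ends the iteration.
\<close>

definition query_step :: "'v set \<Rightarrow> 'v set set \<Rightarrow> 'v state \<Rightarrow> 'v state" where
  "query_step V E s =
     (case oracle_query V E (truth s) (cur s) (hyp s (cur s)) of
        Some (u, v) \<Rightarrow> s\<lparr>hyp := (hyp s)(cur s := v)\<rparr>
      | None \<Rightarrow>
          if cur s < card V then s\<lparr>cur := cur s + 1\<rparr>
          else s\<lparr>cur := 1, iter := iter s + 1\<rparr>)"

definition evolver_step :: "'v set \<Rightarrow> 'v state \<Rightarrow> 'v state" where
  "evolver_step e s = s\<lparr>truth := swap_labels e (truth s)\<rparr>"

text \<open>
  The state after \<open>t\<close> time units, with speedup \<open>c\<close> and the edges \<open>\<omega> 0, \<omega> 1, \<dots>\<close> picked by the
  evolver: every time unit has one query, and after the queries \<open>c, 2 * c, 3 * c, \<dots>\<close> a swap follows.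
\<close>

fun run :: "'v set \<Rightarrow> 'v set set \<Rightarrow> nat \<Rightarrow> 'v state \<Rightarrow> (nat \<Rightarrow> 'v set) \<Rightarrow> nat \<Rightarrow> 'v state" where
  "run V E c s\<^sub>0 \<omega> 0 = s\<^sub>0"
| "run V E c s\<^sub>0 \<omega> (Suc t) =
     (let s = query_step V E (run V E c s\<^sub>0 \<omega> t)
      in if c dvd Suc t then evolver_step (\<omega> (Suc t div c - 1)) s else s)"

text \<open>
  For \<open>c \<ge> 2\<close> every iteration is reached: two consecutive queries with a non-null answer bring the
  current label two edges closer, while the single swap in between moves it by at most one edge.
\<close>

definition iteration_start ::
  "'v set \<Rightarrow> 'v set set \<Rightarrow> nat \<Rightarrow> 'v state \<Rightarrow> (nat \<Rightarrow> 'v set) \<Rightarrow> nat \<Rightarrow> nat" where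
  "iteration_start V E c s\<^sub>0 \<omega> j = (LEAST t. iter (run V E c s\<^sub>0 \<omega> t) = j)"

definition dist_at_iteration ::
  "'v set \<Rightarrow> 'v set set \<Rightarrow> nat \<Rightarrow> 'v state \<Rightarrow> (nat \<Rightarrow> 'v set) \<Rightarrow> nat \<Rightarrow> nat" where
  "dist_at_iteration V E c s\<^sub>0 \<omega> j =
     (let s = run V E c s\<^sub>0 \<omega> (iteration_start V E c s\<^sub>0 \<omega> j)
      in total_dist V E (truth s) (hyp s))"

end

theory Submission
  imports Defs
begin

text \<open>
  Let \<open>w x h\<close> be the distance of a label at \<open>x\<close> from its hypothesis \<open>h\<close>, plus a bonus \<open>\<lambda> = 1 / (\<Delta> + 2)\<close>
  if \<open>x = h\<close>. A random swap increases \<open>\<Phi> = \<Sum> w\<close> by at most \<open>2 - 2 * \<lambda>\<close> in expectation, while two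
  queries and the swap after them, if neither answer is null, decrease the distance by \<open>2\<close> and make at
  most one label correct. So \<open>\<Phi>\<close> has drift at most \<open>- \<lambda>\<close> per swap, up to \<open>1\<close> for every null answer.
  The \<open>n\<close> null answers of an iteration are charged in advance, and they are paid for by subtracting
  \<open>\<eta>\<close> times the distance of the labels still to be processed: this costs less than the drift and
  makes the potential drop by \<open>\<eta> * D\<close> when a new iteration starts.

  For small \<open>\<theta>\<close> the exponential of \<open>\<theta>\<close> times this potential is a supermartingale within an iteration,
  and at an iteration boundary it is either multiplied by at most \<open>exp (- \<theta> * n)\<close> or bounded by
  \<open>exp (O(n))\<close>. Weighting it with the number of iterations left gives a supermartingale up to the start
  of iteration \<open>j\<close>, and Markov's inequality applies as soon as \<open>j > n + 2\<close>, when the initial distance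
  \<open>O(n\<^sup>2)\<close> has been forgotten.
\<close>

section \<open>Distances in trees\<close>

locale finite_tree =
  fixes V :: "'v set" and E :: "'v set set"
  assumes tree: "is_tree V E"
begin

abbreviation d :: "'v \<Rightarrow> 'v \<Rightarrow> nat" where "d \<equiv> tree_dist V E"

lemma finite_V: "finite V" and simple: "simple_graph V E" and connected: "connected_graph V E"
  and acyclic: "\<not> is_cycle V E p"
  using tree unfolding is_tree_def simple_graph_def by blast+

lemma edgeE:
  assumes "e \<in> E"
  obtains u v where "e = {u, v}" "u \<in> V" "v \<in> V" "u \<noteq> v"
  using assms simple unfolding simple_graph_def by blast

lemma edge_in_V: "{u, v} \<in> E \<Longrightarrow> u \<in> V \<and> v \<in> V \<and> u \<noteq> v"
  by (metis edgeE doubleton_eq_iff)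

lemma finite_E: "finite E"
proof -
  have "E \<subseteq> Pow V" using edgeE by blast
  with finite_V show ?thesis using finite_subset by blast
qed

lemma is_path_Cons_iff:
  "is_path V E u (x # y # p) v \<longleftrightarrow>
     u = x \<and> x \<in> V \<and> {x, y} \<in> E \<and> x \<notin> set (y # p) \<and> is_path V E y (y # p) v"
  by (auto simp: is_path_def is_walk_def)

lemma is_path_singleton_iff: "is_path V E u [x] v \<longleftrightarrow> u = x \<and> v = x \<and> x \<in> V"
  by (auto simp: is_path_def is_walk_def)

lemma is_path_rev: "is_path V E u p v \<Longrightarrow> is_path V E v (rev p) u"
  by (auto simp: is_path_def is_walk_def hd_rev last_rev successively_rev insert_commute)

lemma is_path_suffix:
  assumes "is_path V E u (p @ x # q) v" shows "is_path V E x (x # q) v"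
  using assms by (auto simp: is_path_def is_walk_def successively_append_iff)

lemma path_exists:
  assumes "u \<in> V" "v \<in> V"
  obtains p where "is_path V E u p v"
proof -
  have "\<exists>q. is_path V E (hd p) q (last p)" if "is_walk V E p" for p
    using that
  proof (induction p)
    case Nil
    then show ?case by (simp add: is_walk_def)
  next
    case (Cons x p)
    show ?case
    proof (cases p)
      case Nil
      with Cons.prems show ?thesis
        by (auto simp: is_walk_def is_path_singleton_iff intro!: exI[of _ "[x]"])
    next
      case (Cons y p')
      with Cons.prems have w: "is_walk V E p" and e: "{x, y} \<in> E" "x \<in> V"
        by (auto simp: is_walk_def)
      from Cons.IH[OF w] Cons obtain q where q: "is_path V E y q (last p)" by auto
      then obtain q' where q': "q = y # q'"
        by (cases q) (auto simp: is_path_def is_walk_def)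
      show ?thesis
      proof (cases "x \<in> set q")
        case True
        then obtain q1 q2 where "q = q1 @ x # q2" by (meson split_list)
        with q have "is_path V E x (x # q2) (last p)" using is_path_suffix by blast
        with Cons show ?thesis by auto
      next
        case False
        with q q' e have "is_path V E x (x # q) (last p)" by (simp add: is_path_Cons_iff)
        with Cons show ?thesis by auto
      qed
    qed
  qed
  moreover obtain p where "is_walk V E p" "hd p = u" "last p = v"
    using connected assms unfolding connected_graph_def by blast
  ultimately show ?thesis using that by blast
qed

text \<open>If two paths split at \<open>u\<close>, they close a cycle at the first vertex where they meet again.\<close>

lemma path_unique:
  assumes "is_path V E u p v" "is_path V E u q v"
  shows "p = q"
  using assms
proof (induction p arbitrary: u q)
  case Nil
  then show ?case by (simp add: is_path_def is_walk_def)
next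
  case (Cons x p)
  show ?case
  proof (cases "p = [] \<or> tl q = []")
    case True
    have "hd q = x" "q \<noteq> []" using Cons.prems by (auto simp: is_path_def is_walk_def)
    then obtain q' where q': "q = x # q'" by (cases q) auto
    have "last (x # p) = last (x # q')" "distinct (x # p)" "distinct (x # q')"
      using Cons.prems q' by (auto simp: is_path_def)
    with True q' show ?thesis by (auto split: if_splits)
  next
    case False
    then obtain a p' where p: "p = a # p'" by (cases p) auto
    obtain b q' where q: "q = x # b # q'"
      using False Cons.prems by (cases q; cases "tl q") (auto simp: is_path_def is_walk_def)
    have pa: "is_path V E a p v" and xa: "{x, a} \<in> E" "x \<notin> set p" "x \<in> V"
      using Cons.prems(1) unfolding p is_path_Cons_iff by auto
    have qb: "is_path V E b (b # q') v" and xb: "{x, b} \<in> E" "x \<notin> set (b # q')"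
      using Cons.prems(2) unfolding q is_path_Cons_iff by auto
    show ?thesis
    proof (cases "a = b")
      case True
      with Cons.IH[OF pa] qb q show ?thesis by auto
    next
      case False
      have "v \<in> set p" "v \<in> set (b # q')"
        using pa qb by (metis is_path_def is_walk_def last_in_set)+
      then obtain p1 y p2 where y: "p = p1 @ y # p2" "y \<in> set (b # q')"
          "\<forall>z\<in>set p1. z \<notin> set (b # q')"
        using split_list_first_propE[of p "\<lambda>z. z \<in> set (b # q')"] by metis
      then obtain q1 q2 where q1: "b # q' = q1 @ y # q2" by (meson split_list)
      let ?c = "x # p1 @ y # rev q1"
      have "successively (\<lambda>u v. {u, v} \<in> E) (p1 @ [y])"
        using pa y(1) by (auto simp: is_path_def is_walk_def successively_append_iff)
      moreover have "successively (\<lambda>u v. {u, v} \<in> E) (y # rev q1)"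
      proof -
        have "successively (\<lambda>u v. {u, v} \<in> E) (q1 @ [y])"
          using qb q1 by (auto simp: is_path_def is_walk_def successively_append_iff)
        then have "successively (\<lambda>u v. {u, v} \<in> E) (rev (q1 @ [y]))"
          by (subst successively_rev) (simp add: insert_commute)
        then show ?thesis by simp
      qed
      moreover have "{x, hd (p1 @ [y])} \<in> E"
        using xa(1) p y(1) by (cases p1) auto
      ultimately have succ: "successively (\<lambda>u v. {u, v} \<in> E) ?c"
        by (auto simp: successively_append_iff successively_Cons hd_append split: if_splits)
      have "set p \<subseteq> V" "set (b # q') \<subseteq> V" "distinct p" "distinct (b # q')"
        using pa qb by (auto simp: is_path_def is_walk_def)
      then have set: "set ?c \<subseteq> V" and dist: "distinct ?c"
        using y xa xb unfolding q1 y(1) by auto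
      have "{last ?c, x} \<in> E"
        using xb(1) q1 by (cases q1) (auto simp: insert_commute)
      moreover have "length ?c \<ge> 3"
        using False p y(1) q1 by (cases p1; cases q1) auto
      ultimately have "is_cycle V E ?c"
        using succ set dist by (simp add: is_cycle_def is_walk_def)
      with acyclic show ?thesis by blast
    qed
  qed
qed

lemma tree_path_eq: "is_path V E u p v \<Longrightarrow> tree_path V E u v = p"
  unfolding tree_path_def using path_unique by blast

lemma is_path_tree_path: "u \<in> V \<Longrightarrow> v \<in> V \<Longrightarrow> is_path V E u (tree_path V E u v) v"
  by (metis path_exists tree_path_eq)

lemma d_eq: "is_path V E u p v \<Longrightarrow> d u v = length p - 1"
  by (simp add: tree_dist_def tree_path_eq)

lemma d_commute: "u \<in> V \<Longrightarrow> v \<in> V \<Longrightarrow> d u v = d v u"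
  by (metis d_eq is_path_rev is_path_tree_path length_rev)

lemma d_refl [simp]: "u \<in> V \<Longrightarrow> d u u = 0"
  using d_eq[of u "[u]" u] by (simp add: is_path_singleton_iff)

text \<open>The second vertex of the tree path is the oracle's answer. The rest of the path is again
  a path, hence by uniqueness the tree path from there, so a move shortens the distance by exactly
  one.\<close>

lemma path_step:
  assumes "u \<in> V" "v \<in> V" "u \<noteq> v"
  shows "{u, tree_path V E u v ! 1} \<in> E" "d u v = Suc (d (tree_path V E u v ! 1) v)"
proof -
  have p: "is_path V E u (tree_path V E u v) v" using assms is_path_tree_path by blast
  obtain y q where q: "tree_path V E u v = u # y # q"
  proof (cases "tree_path V E u v")
    case Nil
    with p show ?thesis by (simp add: is_path_def is_walk_def)
  next
    case (Cons a r)
    with p assms that show ?thesis by (cases r) (auto simp: is_path_def)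
  qed
  have "{u, y} \<in> E" "is_path V E y (y # q) v"
    using p unfolding q is_path_Cons_iff by auto
  then show "{u, tree_path V E u v ! 1} \<in> E" "d u v = Suc (d (tree_path V E u v ! 1) v)"
    using d_eq[OF p] d_eq[of y "y # q" v] by (simp_all add: q)
qed

lemma d_le_edge:
  assumes "{x, y} \<in> E" "v \<in> V"
  shows "d y v \<le> Suc (d x v)"
proof -
  have V: "x \<in> V" "y \<in> V" "x \<noteq> y" using assms edge_in_V by auto
  have p: "is_path V E x (tree_path V E x v) v" using V assms is_path_tree_path by blast
  show ?thesis
  proof (cases "y \<in> set (tree_path V E x v)")
    case True
    then obtain q1 q2 where q: "tree_path V E x v = q1 @ y # q2" by (meson split_list)
    with p have "is_path V E y (y # q2) v" using is_path_suffix by metis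
    with d_eq[OF p] d_eq[of y "y # q2" v] q show ?thesis by auto
  next
    case False
    obtain r where r: "tree_path V E x v = x # r"
      using p by (cases "tree_path V E x v") (auto simp: is_path_def is_walk_def)
    have "is_path V E y (y # x # r) v"
      using False p assms V unfolding r by (auto simp: is_path_Cons_iff insert_commute)
    with d_eq[OF p] d_eq[of y "y # x # r" v] r show ?thesis by auto
  qed
qed

lemma d_less_card:
  assumes "u \<in> V" "v \<in> V" shows "d u v < card V"
proof -
  have p: "is_path V E u (tree_path V E u v) v" using assms is_path_tree_path by blast
  then have "length (tree_path V E u v) = card (set (tree_path V E u v))"
    "set (tree_path V E u v) \<subseteq> V" "tree_path V E u v \<noteq> []"
    by (auto simp: is_path_def is_walk_def distinct_card)
  moreover have "card (set (tree_path V E u v)) \<le> card V"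
    using calculation finite_V card_mono by blast
  ultimately show ?thesis by (cases "tree_path V E u v") (auto simp: tree_dist_def)
qed

lemma E_nonempty: "card V \<ge> 2 \<Longrightarrow> E \<noteq> {}"
proof -
  assume "card V \<ge> 2"
  then obtain u v where "u \<in> V" "v \<in> V" "u \<noteq> v"
    by (metis One_nat_def card_2_iff' card_le_Suc0_iff_eq finite_V not_less_eq_eq numeral_2_eq_2)
  then show "E \<noteq> {}" using path_step(1) by blast
qed

end

section \<open>Drift of the potential\<close>

lemma exp_le_quadratic:
  fixes x :: real
  assumes "\<bar>x\<bar> \<le> 1"
  shows "exp x \<le> 1 + x + x\<^sup>2"
proof (cases "x \<ge> 0")
  case True
  then show ?thesis using exp_bound assms by simp
next
  case False
  define y where "y = - x"
  have y: "y > 0" using False by (simp add: y_def)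
  \<comment> \<open>The claimed bound for \<open>exp (- y)\<close> times a Taylor lower bound for
    \<open>exp y\<close> is at least \<open>1\<close>.\<close>
  have "1 \<le> (1 - y + y\<^sup>2) * (1 + y + y\<^sup>2 / 2)"
  proof -
    have "(1 - y + y\<^sup>2) * (1 + y + y\<^sup>2 / 2) = 1 + y\<^sup>2 / 2 + y ^ 3 / 2 + y ^ 4 / 2"
      by (simp add: field_simps power2_eq_square power3_eq_cube power4_eq_xxxx)
    with y show ?thesis by simp
  qed
  also have "\<dots> \<le> (1 - y + y\<^sup>2) * exp y"
  proof (rule mult_left_mono)
    show "1 + y + y\<^sup>2 / 2 \<le> exp y" using exp_lower_Taylor_quadratic y by simp
    have "1 - y + y\<^sup>2 = (1 - y / 2)\<^sup>2 + 3 / 4 * y\<^sup>2"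
      by (simp add: power2_eq_square algebra_simps)
    then show "0 \<le> 1 - y + y\<^sup>2" by simp
  qed
  finally have "exp (- y) \<le> 1 - y + y\<^sup>2"
    by (simp add: exp_minus divide_simps mult.commute)
  then show ?thesis by (simp add: y_def)
qed

text \<open>The quadratic bound on \<open>exp\<close> bounds the average of
  \<open>exp (\<theta> * Y e)\<close> by
  \<open>1 - \<theta> * \<nu> + \<theta>\<^sup>2 * b\<^sup>2\<close>, and the negative drift absorbs
  the last term. Expectations over a uniform edge are written as sums compared with the number of
  edges.\<close>

lemma sum_exp_le_card:
  fixes Y :: "'a \<Rightarrow> real"
  assumes "\<And>e. e \<in> S \<Longrightarrow> \<bar>Y e\<bar> \<le> b" "sum Y S \<le> - (\<nu> * real (card S))"
    and "\<theta> \<ge> 0" "\<theta> * b \<le> 1" "\<theta> * b\<^sup>2 \<le> \<nu>"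
  shows "(\<Sum>e\<in>S. exp (\<theta> * Y e)) \<le> real (card S)"
proof -
  have "exp (\<theta> * Y e) \<le> 1 + \<theta> * Y e + \<theta>\<^sup>2 * b\<^sup>2" if "e \<in> S" for e
  proof -
    have "\<bar>\<theta> * Y e\<bar> \<le> \<theta> * b"
      using assms(1)[OF that] assms(3) by (simp add: abs_mult mult_left_mono)
    then have "exp (\<theta> * Y e) \<le> 1 + \<theta> * Y e + (\<theta> * Y e)\<^sup>2"
      using assms(4) by (intro exp_le_quadratic) simp
    moreover have "(Y e)\<^sup>2 \<le> b\<^sup>2"
      using assms(1)[OF that] by (metis abs_le_square_iff abs_of_nonneg abs_ge_zero order_trans)
    ultimately show ?thesis
      using mult_left_mono[of "(Y e)\<^sup>2" "b\<^sup>2" "\<theta>\<^sup>2"] by (simp add: power_mult_distrib)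
  qed
  then have "(\<Sum>e\<in>S. exp (\<theta> * Y e)) \<le> (\<Sum>e\<in>S. 1 + \<theta> * Y e + \<theta>\<^sup>2 * b\<^sup>2)"
    by (rule sum_mono)
  also have "\<dots> = real (card S) + \<theta> * sum Y S + real (card S) * (\<theta> * (\<theta> * b\<^sup>2))"
    by (simp add: sum.distrib sum_distrib_left power2_eq_square algebra_simps)
  also have "\<dots> \<le> real (card S) + \<theta> * (- (\<nu> * real (card S))) + real (card S) * (\<theta> * \<nu>)"
    using assms by (intro add_mono mult_left_mono) auto
  finally show ?thesis by (simp add: algebra_simps)
qed

section \<open>Weights of the labels and their mean change under a random swap\<close>

locale tracking = finite_tree V E for V :: "'v set" and E :: "'v set set" +
  fixes \<Delta> :: nat
  assumes card_V: "card V \<ge> 2" and degree: "max_degree V E \<le> \<Delta>"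
begin

definition lam :: real where "lam = 1 / (real \<Delta> + 2)"

text \<open>Small enough that the \<open>eta\<close> terms, two from the queries and two from the
  swap, use up only half of the drift \<open>- lam\<close> of a pair of queries.\<close>

definition eta :: real where "eta = lam / 8"

definition w :: "'v \<Rightarrow> 'v \<Rightarrow> real" where
  "w x h = real (d x h) + (if x = h then lam else 0)"

lemma lam_bounds: "0 < lam" "lam \<le> 1 / 2"
  by (auto simp: lam_def divide_simps)

lemma eta_bounds: "0 < eta" "eta \<le> 1 / 16"
  using lam_bounds by (auto simp: eta_def)

lemma vertex_degree_le: "x \<in> V \<Longrightarrow> vertex_degree E x \<le> \<Delta>"
  using degree finite_V unfolding max_degree_def by (meson Max_ge finite_imageI imageI order_trans)

lemma other_endpoint:
  assumes "e \<in> E" "x \<in> e"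
  shows "e = {x, the_elem (e - {x})}" "the_elem (e - {x}) \<in> V" "x \<in> V" "the_elem (e - {x}) \<noteq> x"
proof -
  obtain y where y: "e = {x, y}" "x \<in> V" "y \<in> V" "x \<noteq> y"
    using assms by (metis edgeE insertE insert_commute singletonD)
  then have "e - {x} = {y}" by auto
  with y show "e = {x, the_elem (e - {x})}" "the_elem (e - {x}) \<in> V" "x \<in> V"
      "the_elem (e - {x}) \<noteq> x"
    by simp_all
qed

lemma d_other:
  assumes "e \<in> E" "x \<in> e" "h \<in> V"
  shows "d (the_elem (e - {x})) h \<le> d x h + 1" "d x h \<le> d (the_elem (e - {x})) h + 1"
  using other_endpoint[OF assms(1,2)] assms d_le_edge
  by (metis Suc_eq_plus1 insert_commute)+

lemma w_bounds: "real (d x h) \<le> w x h" "w x h \<le> real (d x h) + 1 / 2"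
  using lam_bounds by (simp_all add: w_def)

lemma w_other:
  assumes "e \<in> E" "x \<in> e" "h \<in> V"
  shows "\<bar>w (the_elem (e - {x})) h - w x h\<bar> \<le> 3 / 2"
proof -
  have "real (d (the_elem (e - {x})) h) \<le> real (d x h) + 1"
    "real (d x h) \<le> real (d (the_elem (e - {x})) h) + 1"
    using d_other[OF assms] by linarith+
  with w_bounds[of x h] w_bounds[of "the_elem (e - {x})" h] show ?thesis by linarith
qed

text \<open>A misplaced label is moved towards its hypothesis by one of the edges at its vertex; a correctly
  placed one loses its bonus \<open>lam\<close> with each of them. The choice of \<open>lam\<close> balances the two cases.\<close>

lemma sum_w_incident:
  assumes "x \<in> V" "h \<in> V"
  shows "(\<Sum>e\<in>{e \<in> E. x \<in> e}. w (the_elem (e - {x})) h - w x h) \<le> (1 - lam) * real (vertex_degree E x)"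
proof (cases "x = h")
  case True
  have "w (the_elem (e - {x})) h - w x h \<le> 1 - lam" if "e \<in> {e \<in> E. x \<in> e}" for e
    using that d_other[of e x h] other_endpoint[of e x] True assms by (auto simp: w_def)
  then have "(\<Sum>e\<in>{e \<in> E. x \<in> e}. w (the_elem (e - {x})) h - w x h) \<le>
      real (card {e \<in> E. x \<in> e}) * (1 - lam)"
    by (rule sum_bounded_above)
  then show ?thesis by (simp add: vertex_degree_def mult.commute)
next
  case False
  let ?S = "{e \<in> E. x \<in> e}"
  define e0 where "e0 = {x, tree_path V E x h ! 1}"
  have e0: "e0 \<in> ?S" and d0: "d x h = Suc (d (tree_path V E x h ! 1) h)"
    using path_step[OF assms False] by (auto simp: e0_def)
  have "the_elem (e0 - {x}) = tree_path V E x h ! 1"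
    using other_endpoint[of e0 x] e0 by (auto simp: e0_def doubleton_eq_iff)
  with d0 False have t0: "w (the_elem (e0 - {x})) h - w x h \<le> lam - 1"
    using lam_bounds by (auto simp: w_def)
  have "w (the_elem (e - {x})) h - w x h \<le> 1" if "e \<in> ?S - {e0}" for e
    using that d_other[of e x h] assms False lam_bounds by (auto simp: w_def)
  then have "(\<Sum>e\<in>?S - {e0}. w (the_elem (e - {x})) h - w x h) \<le> real (card (?S - {e0})) * 1"
    by (rule sum_bounded_above)
  also have "\<dots> = real (vertex_degree E x) - 1"
    using e0 finite_E card.remove[of ?S e0] by (simp add: vertex_degree_def)
  finally have "(\<Sum>e\<in>?S. w (the_elem (e - {x})) h - w x h) \<le> real (vertex_degree E x) - 2 + lam"
    using e0 finite_E t0 by (subst sum.remove[of _ e0]) auto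
  \<comment> \<open>With \<open>deg\<close> the degree of \<open>x\<close>,
    \<open>deg - 2 + lam \<le> (1 - lam) * deg\<close> means \<open>lam * (1 + deg) \<le> 2\<close>;
    here the degree bound enters.\<close>
  moreover have "lam * (1 + real (vertex_degree E x)) \<le> lam * (1 + real \<Delta>)"
    using vertex_degree_le[OF assms(1)] lam_bounds by (intro mult_left_mono) auto
  moreover have "lam * (1 + real \<Delta>) \<le> 2" by (simp add: lam_def divide_simps)
  ultimately show ?thesis by (simp add: algebra_simps)
qed

lemma sum_vertex_degree: "(\<Sum>v\<in>V. vertex_degree E v) = 2 * card E"
proof -
  have "(\<Sum>v\<in>V. vertex_degree E v) = (\<Sum>v\<in>V. \<Sum>e\<in>E. if v \<in> e then 1 else 0)"
    using finite_E by (simp add: vertex_degree_def sum.If_cases Int_def)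
  also have "\<dots> = (\<Sum>e\<in>E. \<Sum>v\<in>V. if v \<in> e then 1 else 0)"
    by (rule sum.swap)
  also have "\<dots> = (\<Sum>e\<in>E. 2)"
  proof (rule sum.cong[OF refl])
    fix e assume "e \<in> E"
    then obtain u v where uv: "e = {u, v}" "u \<in> V" "v \<in> V" "u \<noteq> v" by (rule edgeE)
    then have "{x \<in> V. x \<in> e} = {u, v}" by auto
    with uv finite_V show "(\<Sum>v\<in>V. if v \<in> e then 1 else 0) = (2 :: nat)"
      by (simp add: sum.If_cases Int_def)
  qed
  finally show ?thesis by simp
qed

definition valid :: "'v state \<Rightarrow> bool" where
  "valid s \<longleftrightarrow> bij_betw (truth s) (labels V) V \<and> hyp s \<in> labels V \<rightarrow> V \<and> cur s \<in> labels V"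

lemma validD:
  assumes "valid s"
  shows "bij_betw (truth s) (labels V) V" "cur s \<in> labels V"
    and "l \<in> labels V \<Longrightarrow> truth s l \<in> V" "l \<in> labels V \<Longrightarrow> hyp s l \<in> V"
  using assms by (auto simp: valid_def bij_betw_def)

lemma finite_labels [simp]: "finite (labels V)"
  by (simp add: labels_def)

definition swap_part :: "('v \<Rightarrow> 'v \<Rightarrow> real) \<Rightarrow> 'v set \<Rightarrow> 'v state \<Rightarrow> nat \<Rightarrow> real" where
  "swap_part f e s l =
     (if truth s l \<in> e then f (the_elem (e - {truth s l})) (hyp s l) - f (truth s l) (hyp s l) else 0)"

lemma swap_labels_bij:
  assumes "e \<in> E" "bij_betw M (labels V) V"
  shows "bij_betw (swap_labels e M) (labels V) V"
proof -
  define \<sigma> where "\<sigma> = (\<lambda>x. if x \<in> e then the_elem (e - {x}) else x)"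
  obtain u v where uv: "e = {u, v}" "u \<in> V" "v \<in> V" "u \<noteq> v" using assms(1) by (rule edgeE)
  have s: "\<sigma> x = (if x = u then v else if x = v then u else x)" for x
  proof -
    have "{u, v} - {u} = {v}" "{u, v} - {v} = {u}" using uv by auto
    then show ?thesis by (auto simp: \<sigma>_def uv(1))
  qed
  have "bij_betw \<sigma> V V"
    by (rule bij_betw_byWitness[where f' = \<sigma>]) (use uv in \<open>auto simp: s\<close>)
  from bij_betw_trans[OF assms(2) this] show ?thesis
    by (simp add: swap_labels_def \<sigma>_def comp_def)
qed

lemma valid_evolver_step: "e \<in> E \<Longrightarrow> valid s \<Longrightarrow> valid (evolver_step e s)"
  by (simp add: valid_def evolver_step_def swap_labels_bij)

lemma sum_evolver_step:
  "(\<Sum>l\<in>L. f (truth (evolver_step e s) l) (hyp (evolver_step e s) l)) - (\<Sum>l\<in>L. f (truth s l) (hyp s l)) =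
     (\<Sum>l\<in>L. swap_part f e s l)"
  unfolding sum_subtractf[symmetric]
  by (rule sum.cong) (auto simp: swap_part_def evolver_step_def swap_labels_def)

text \<open>Each endpoint of \<open>e\<close> carries at most one label of \<open>L\<close>, so at
  most two terms are nonzero.\<close>

lemma swap_part_bound:
  assumes "valid s" "e \<in> E" "L \<subseteq> labels V" "b \<ge> 0"
    and b: "\<And>x h. x \<in> e \<Longrightarrow> h \<in> V \<Longrightarrow> \<bar>f (the_elem (e - {x})) h - f x h\<bar> \<le> b"
  shows "\<bar>\<Sum>l\<in>L. swap_part f e s l\<bar> \<le> 2 * b"
proof -
  have fin: "finite L" using assms(3) finite_labels finite_subset by blast
  have "\<bar>\<Sum>l\<in>L. swap_part f e s l\<bar> \<le> (\<Sum>l\<in>L. \<bar>swap_part f e s l\<bar>)" by (rule sum_abs)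
  also have "\<dots> \<le> (\<Sum>l\<in>L. if truth s l \<in> e then b else 0)"
    using assms validD[OF assms(1)] by (intro sum_mono) (auto simp: swap_part_def)
  also have "\<dots> = b * real (card {l \<in> L. truth s l \<in> e})"
    using fin by (simp add: sum.If_cases Int_def)
  also have "\<dots> \<le> b * 2"
  proof -
    obtain u v where "e = {u, v}" "u \<noteq> v" using assms(2) by (rule edgeE)
    then have "card e = 2" by simp
    moreover have "card {l \<in> L. truth s l \<in> e} \<le> card e"
    proof (rule card_inj_on_le)
      show "inj_on (truth s) {l \<in> L. truth s l \<in> e}"
        using validD(1)[OF assms(1)] assms(3) by (auto simp: bij_betw_def inj_on_def)
      show "finite e" using \<open>card e = 2\<close> card.infinite by fastforce
    qed auto
    ultimately have "real (card {l \<in> L. truth s l \<in> e}) \<le> 2" by simp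
    then show ?thesis using assms(4) by (intro mult_left_mono)
  qed
  finally show ?thesis by simp
qed

text \<open>A label at \<open>x\<close> contributes at most \<open>1 - lam\<close> times the degree
  of \<open>x\<close>. Each vertex carries exactly one label, so these degrees sum to
  \<open>2 * card E\<close>.\<close>

lemma sum_swap_part_w:
  assumes "valid s"
  shows "(\<Sum>e\<in>E. \<Sum>l\<in>labels V. swap_part w e s l) \<le> (2 - 2 * lam) * real (card E)"
proof -
  have "(\<Sum>e\<in>E. \<Sum>l\<in>labels V. swap_part w e s l) = (\<Sum>l\<in>labels V. \<Sum>e\<in>E. swap_part w e s l)"
    by (rule sum.swap)
  also have "\<dots> \<le> (\<Sum>l\<in>labels V. (1 - lam) * real (vertex_degree E (truth s l)))"
  proof (rule sum_mono)
    fix l assume l: "l \<in> labels V"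
    have "(\<Sum>e\<in>E. swap_part w e s l) =
        (\<Sum>e\<in>{e \<in> E. truth s l \<in> e}. w (the_elem (e - {truth s l})) (hyp s l) - w (truth s l) (hyp s l))"
      unfolding swap_part_def using finite_E by (subst sum.If_cases) (auto simp: Int_def)
    with sum_w_incident validD(3,4)[OF assms l]
    show "(\<Sum>e\<in>E. swap_part w e s l) \<le> (1 - lam) * real (vertex_degree E (truth s l))" by simp
  qed
  also have "\<dots> = (1 - lam) * real (\<Sum>v\<in>V. vertex_degree E v)"
    using sum.reindex_bij_betw[OF validD(1)[OF assms], of "\<lambda>v. real (vertex_degree E v)"]
    by (simp add: sum_distrib_left[symmetric])
  finally show ?thesis by (simp add: sum_vertex_degree algebra_simps)
qed

section \<open>The potential under single queries and swaps\<close>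

definition Phi :: "'v state \<Rightarrow> real" where
  "Phi s = (\<Sum>l\<in>labels V. w (truth s l) (hyp s l))"

definition U :: "'v state \<Rightarrow> real" where
  "U s = (\<Sum>l\<in>{cur s..card V}. real (d (truth s l) (hyp s l)))"

text \<open>The last summand counts the null answers still due, one for each label from
  \<open>cur s\<close> on.\<close>

definition Psi :: "'v state \<Rightarrow> real" where
  "Psi s = Phi s - eta * U s + (real (card V) + 1 - real (cur s))"

definition correct :: "'v state \<Rightarrow> bool" where
  "correct s \<longleftrightarrow> truth s (cur s) = hyp s (cur s)"

text \<open>At odd times the first query of a pair is done and its swap is still to come. The \<open>lam\<close> term there
  records that a query making the current label correct is followed by a null answer before the swap,
  so that a pair of queries gains the bonus at most once.\<close>

definition X :: "nat \<Rightarrow> 'v state \<Rightarrow> real" where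
  "X t s = Psi s + (if odd t then 1 - eta - (if correct s then lam else 0) else 0)"

lemma Phi_evolver_step:
  assumes "valid s" "e \<in> E"
  shows "\<bar>Phi (evolver_step e s) - Phi s\<bar> \<le> 3"
  unfolding Phi_def sum_evolver_step
  using swap_part_bound[OF assms order_refl, of "3 / 2" w] w_other assms(2) by auto

lemma U_evolver_step:
  assumes "valid s" "e \<in> E"
  shows "\<bar>U (evolver_step e s) - U s\<bar> \<le> 2"
proof -
  let ?f = "\<lambda>x h. real (d x h)"
  have "\<bar>?f (the_elem (e - {x})) h - ?f x h\<bar> \<le> 1" if "x \<in> e" "h \<in> V" for x h
    using d_other[OF assms(2) that] by auto
  from swap_part_bound[of s e "{cur s..card V}" 1 ?f, OF assms _ _ this]
  have "\<bar>\<Sum>l\<in>{cur s..card V}. swap_part ?f e s l\<bar> \<le> 2"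
    using validD(2)[OF assms(1)] by (auto simp: labels_def)
  moreover have "cur (evolver_step e s) = cur s" by (simp add: evolver_step_def)
  ultimately show ?thesis
    using sum_evolver_step[of ?f e s "{cur s..card V}"] by (simp add: U_def)
qed

text \<open>\<open>Phi\<close> is averaged over the edges, whereas \<open>U\<close> enters only with
  its worst case \<open>2\<close>, whose share \<open>2 * eta\<close> is small.\<close>

lemma Psi_evolver_step:
  assumes "valid s"
  shows "e \<in> E \<Longrightarrow> \<bar>Psi (evolver_step e s) - Psi s\<bar> \<le> 4"
    and "(\<Sum>e\<in>E. Psi (evolver_step e s) - Psi s) \<le> (2 - 2 * lam + 2 * eta) * real (card E)"
proof -
  have eq: "Psi (evolver_step e s) - Psi s =
      (Phi (evolver_step e s) - Phi s) - eta * (U (evolver_step e s) - U s)" for e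
    by (simp add: Psi_def evolver_step_def algebra_simps)
  have U: "\<bar>eta * (U (evolver_step e s) - U s)\<bar> \<le> 2 * eta" if "e \<in> E" for e
    using U_evolver_step[OF assms that] eta_bounds by (simp add: abs_mult)
  show "\<bar>Psi (evolver_step e s) - Psi s\<bar> \<le> 4" if "e \<in> E" for e
    using U[OF that] Phi_evolver_step[OF assms that] eta_bounds unfolding eq by linarith
  have "(\<Sum>e\<in>E. Psi (evolver_step e s) - Psi s) \<le> (\<Sum>e\<in>E. (\<Sum>l\<in>labels V. swap_part w e s l) + 2 * eta)"
  proof (rule sum_mono)
    fix e assume "e \<in> E"
    from U[OF this] show "Psi (evolver_step e s) - Psi s \<le> (\<Sum>l\<in>labels V. swap_part w e s l) + 2 * eta"
      unfolding eq sum_evolver_step[symmetric] Phi_def by linarith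
  qed
  also have "\<dots> \<le> (2 - 2 * lam) * real (card E) + 2 * eta * real (card E)"
    using sum_swap_part_w[OF assms] by (simp add: sum.distrib)
  finally show "(\<Sum>e\<in>E. Psi (evolver_step e s) - Psi s) \<le> (2 - 2 * lam + 2 * eta) * real (card E)"
    by (simp add: algebra_simps)
qed

lemma query_step_move:
  assumes "valid s" "\<not> correct s"
  obtains v where "query_step V E s = s\<lparr>hyp := (hyp s)(cur s := v)\<rparr>" "v \<in> V"
    "d (truth s (cur s)) (hyp s (cur s)) = Suc (d (truth s (cur s)) v)"
proof -
  let ?x = "truth s (cur s)" and ?h = "hyp s (cur s)"
  let ?v = "tree_path V E ?h ?x ! 1"
  have V: "?x \<in> V" "?h \<in> V" using validD[OF assms(1)] by blast+
  have ne: "?h \<noteq> ?x" using assms(2) by (auto simp: correct_def)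
  note p = path_step[OF V(2,1) ne]
  have v: "?v \<in> V" using p(1) edge_in_V by blast
  have "query_step V E s = s\<lparr>hyp := (hyp s)(cur s := ?v)\<rparr>"
    using ne by (simp add: query_step_def oracle_query_def)
  moreover have "d ?x ?h = Suc (d ?x ?v)"
    using p(2) d_commute V v by metis
  ultimately show ?thesis using that v by blast
qed

lemma query_step_null:
  assumes "correct s"
  shows "query_step V E s =
     (if cur s < card V then s\<lparr>cur := cur s + 1\<rparr> else s\<lparr>cur := 1, iter := iter s + 1\<rparr>)"
  using assms by (simp add: query_step_def oracle_query_def correct_def)

lemma valid_query_step:
  assumes "valid s" shows "valid (query_step V E s)"
proof (cases "correct s")
  case True
  then show ?thesis
    using assms card_V by (auto simp: query_step_null valid_def labels_def)
next
  case False
  with assms obtain v where "query_step V E s = s\<lparr>hyp := (hyp s)(cur s := v)\<rparr>" "v \<in> V"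
    by (rule query_step_move)
  with assms show ?thesis by (auto simp: valid_def Pi_iff)
qed

lemma Psi_move:
  assumes "valid s" "\<not> correct s"
  shows "Psi (query_step V E s) = Psi s - 1 + eta + (if correct (query_step V E s) then lam else 0)"
proof -
  from assms obtain v where v: "query_step V E s = s\<lparr>hyp := (hyp s)(cur s := v)\<rparr>" "v \<in> V"
      "d (truth s (cur s)) (hyp s (cur s)) = Suc (d (truth s (cur s)) v)"
    by (rule query_step_move)
  have c: "cur s \<in> labels V" using validD[OF assms(1)] by blast
  have P: "Phi (query_step V E s) = Phi s - 1 + (if correct (query_step V E s) then lam else 0)"
    using v assms(2) by (simp add: Phi_def sum.remove[OF _ c] w_def correct_def)
  have W: "U (query_step V E s) = U s - 1"
    using v c by (simp add: U_def labels_def sum.remove[of "{cur s..card V}" "cur s"])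
  have C: "cur (query_step V E s) = cur s" using v(1) by simp
  show ?thesis unfolding Psi_def P W C by (simp add: algebra_simps)
qed

lemma Psi_null:
  assumes "valid s" "correct s" "cur s < card V"
  shows "Psi (query_step V E s) = Psi s - 1"
proof -
  have "{cur s..card V} = insert (cur s) {cur s + 1..card V}" using assms(3) by auto
  then have "U s = U (s\<lparr>cur := cur s + 1\<rparr>)"
    using assms validD[OF assms(1)] by (simp add: U_def correct_def)
  with assms show ?thesis
    by (simp add: query_step_null Psi_def Phi_def)
qed

text \<open>The correction in \<open>X\<close> at odd times is chosen such that a move leaves
  \<open>X\<close> unchanged; a null answer lowers it.\<close>

lemma X_even_step:
  assumes "valid s" "even t" "\<not> (correct s \<and> cur s = card V)"
  shows "X (Suc t) (query_step V E s) \<le> X t s"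
proof (cases "correct s")
  case True
  with assms validD(2)[OF assms(1)] have "cur s < card V" by (auto simp: labels_def)
  from Psi_null[OF assms(1) True this] assms(2) lam_bounds eta_bounds show ?thesis
    by (simp add: X_def)
next
  case False
  from Psi_move[OF assms(1) False] assms(2) show ?thesis by (simp add: X_def)
qed

text \<open>\<open>q\<close> collects the second query and the removal of the correction at odd
  times; the swap adds at most \<open>2 - 2 * lam + 2 * eta\<close> on average. With the upper bound
  on \<open>q\<close> the sum is \<open>- lam + 4 * eta = - lam / 2\<close>. The bound
  \<open>6\<close> is \<open>4\<close> for the swap plus \<open>2\<close> for
  \<open>q\<close>.\<close>

lemma X_odd_step:
  assumes "valid s" "odd t" "\<not> (correct s \<and> cur s = card V)"
  defines "Y \<equiv> \<lambda>e. X (Suc t) (evolver_step e (query_step V E s)) - X t s"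
  shows "e \<in> E \<Longrightarrow> \<bar>Y e\<bar> \<le> 6" and "(\<Sum>e\<in>E. Y e) \<le> - (lam / 2 * real (card E))"
proof -
  let ?s = "query_step V E s"
  define q where "q = Psi ?s - X t s"
  have q: "-2 \<le> q" "q \<le> -2 + 2 * eta + lam"
  proof -
    have "-2 \<le> q \<and> q \<le> -2 + 2 * eta + lam"
    proof (cases "correct s")
      case True
      with assms validD(2)[OF assms(1)] have "cur s < card V" by (auto simp: labels_def)
      from Psi_null[OF assms(1) True this] assms(2) True lam_bounds eta_bounds show ?thesis
        by (simp add: X_def q_def)
    next
      case False
      from Psi_move[OF assms(1) False] assms(2) False lam_bounds eta_bounds show ?thesis
        by (simp add: X_def q_def)
    qed
    then show "-2 \<le> q" "q \<le> -2 + 2 * eta + lam" by auto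
  qed
  have Y: "Y e = (Psi (evolver_step e ?s) - Psi ?s) + q" for e
    using assms(2) by (simp add: Y_def q_def X_def)
  note v = valid_query_step[OF assms(1)]
  show "\<bar>Y e\<bar> \<le> 6" if "e \<in> E"
    using Psi_evolver_step(1)[OF v that] q lam_bounds eta_bounds unfolding Y by linarith
  have "(\<Sum>e\<in>E. Y e) \<le> (2 - 2 * lam + 2 * eta) * real (card E) + q * real (card E)"
    using Psi_evolver_step(2)[OF v] by (simp add: Y sum.distrib mult.commute)
  also have "\<dots> = (2 - 2 * lam + 2 * eta + q) * real (card E)" by (simp add: algebra_simps)
  also have "\<dots> \<le> (- (lam / 2)) * real (card E)"
    using q by (intro mult_right_mono) (auto simp: eta_def)
  finally show "(\<Sum>e\<in>E. Y e) \<le> - (lam / 2 * real (card E))" by simp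
qed

section \<open>Iteration boundaries and the exponential supermartingale\<close>

definition D :: "'v state \<Rightarrow> real" where
  "D s = real (total_dist V E (truth s) (hyp s))"

lemma D_nonneg: "0 \<le> D s" by (simp add: D_def)

lemma Phi_le: "Phi s \<le> D s + lam * real (card V)"
proof -
  have "Phi s \<le> (\<Sum>l\<in>labels V. real (d (truth s l) (hyp s l)) + lam)"
    unfolding Phi_def w_def using lam_bounds by (intro sum_mono) auto
  also have "\<dots> = D s + lam * real (card V)"
    by (simp add: D_def total_dist_def sum.distrib labels_def)
  finally show ?thesis .
qed

lemma Phi_ge: "D s \<le> Phi s"
  unfolding Phi_def D_def total_dist_def of_nat_sum w_def
  using lam_bounds by (intro sum_mono) auto

lemma D_le:
  assumes "valid s" shows "D s \<le> (real (card V))\<^sup>2"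
proof -
  have "D s \<le> (\<Sum>l\<in>labels V. real (card V))"
    unfolding D_def total_dist_def of_nat_sum
    by (intro sum_mono) (simp add: d_less_card less_imp_le validD[OF assms])
  also have "\<dots> = (real (card V))\<^sup>2" by (simp add: labels_def power2_eq_square)
  finally show ?thesis .
qed

lemma Psi_start: "cur s = 1 \<Longrightarrow> Psi s = Phi s - eta * D s + real (card V)"
  by (simp add: Psi_def U_def D_def labels_def total_dist_def)

definition next_state :: "nat \<Rightarrow> 'v set \<Rightarrow> 'v state \<Rightarrow> 'v state" where
  "next_state t e s =
     (if odd t then evolver_step e (query_step V E s) else query_step V E s)"

text \<open>If the boundary leaves \<open>D\<close> at most \<open>4 / eta * card V\<close>, the new
  potential is at most this multiple of \<open>card V\<close>; the \<open>3\<close> leaves room for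
  the bonuses and the null answers to come.\<close>

definition cross_const :: real where "cross_const = 4 / eta + 3"

text \<open>At the end of an iteration the potential gains \<open>card V\<close> for the null answers to come and loses
  \<open>eta * D\<close>, which wins as soon as \<open>D\<close> is a large multiple of \<open>card V\<close>.\<close>

lemma X_boundary:
  assumes "valid s" "correct s" "cur s = card V" "e \<in> E"
  shows "X (Suc t) (next_state t e s) \<le> max (X t s - real (card V)) (cross_const * real (card V))"
proof -
  let ?s = "query_step V E s" and ?s' = "next_state t e s"
  have v: "valid ?s" using assms valid_query_step by blast
  have q: "?s = s\<lparr>cur := 1, iter := iter s + 1\<rparr>" using assms by (simp add: query_step_null)
  have "Phi ?s = Phi s" by (simp add: q Phi_def)
  with Phi_evolver_step[OF v assms(4)] have 1: "Phi ?s' \<le> Phi s + 3"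
    by (auto simp: next_state_def)
  have "cur ?s' = 1" by (simp add: next_state_def q evolver_step_def)
  then have 2: "X (Suc t) ?s' \<le> Phi ?s' - eta * D ?s' + real (card V) + 1"
    using lam_bounds eta_bounds by (simp add: X_def Psi_start)
  have "d (truth s (cur s)) (hyp s (cur s)) = 0"
    using assms validD[OF assms(1)] by (metis correct_def d_refl)
  then have "U s = 0" using assms by (simp add: U_def)
  then have 3: "Phi s + 1 \<le> X t s"
    using assms lam_bounds eta_bounds by (simp add: X_def Psi_def)
  have n: "real (card V) \<ge> 2" using card_V by simp
  show ?thesis
  proof (cases "2 * real (card V) + 4 \<le> eta * D ?s'")
    \<comment> \<open>Twice \<open>card V\<close>: once for the null answers of the new iteration,
      once for the decrease to be shown. The \<open>4\<close> covers the swap and the other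
      constants.\<close>
    case True
    with 1 2 3 have "X (Suc t) ?s' \<le> X t s - real (card V)" by linarith
    then show ?thesis by simp
  next
    case False
    then have "eta * D ?s' \<le> 4 * real (card V)" using n by linarith
    then have "D ?s' \<le> 4 / eta * real (card V)" using eta_bounds by (simp add: field_simps)
    moreover have "lam * real (card V) \<le> 1 / 2 * real (card V)"
      using lam_bounds by (intro mult_right_mono) auto
    moreover have "0 \<le> eta * D ?s'" using eta_bounds D_nonneg by simp
    ultimately have "X (Suc t) ?s' \<le> cross_const * real (card V)"
      using 2 Phi_le[of ?s'] n unfolding cross_const_def distrib_right by linarith
    then show ?thesis by simp
  qed
qed

text \<open>Over a swap \<open>X\<close> changes by at most \<open>6\<close> and has drift at most
  \<open>- lam / 2\<close>; this value gives \<open>theta * 6\<^sup>2 = lam / 2\<close>, which meets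
  the requirement of \<open>sum_exp_le_card\<close> with equality.\<close>

definition theta :: real where "theta = lam / 72"

lemma theta_bounds: "0 < theta" "theta \<le> 1 / 144"
  using lam_bounds by (auto simp: theta_def)

text \<open>At a boundary \<open>exp (theta * X)\<close> becomes at most
  \<open>q * exp (theta * X) + A\<close> with \<open>q = exp (- theta * card V)\<close> and
  \<open>A = exp (theta * cross_const * card V)\<close>. \<open>F\<close> iterates this affine bound
  over the boundaries up to the start of iteration \<open>j\<close>, where only
  \<open>exp (theta * X)\<close> is left.\<close>

definition F :: "nat \<Rightarrow> nat \<Rightarrow> 'v state \<Rightarrow> real" where
  "F j t s = exp (- theta * real (card V)) ^ (j - iter s) * exp (theta * X t s) +
     exp (theta * (cross_const * real (card V))) * (\<Sum>i<j - iter s. exp (- theta * real (card V)) ^ i)"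

text \<open>\<open>iter\<close> does not change, so only \<open>exp (theta * X)\<close> matters. It
  cannot grow at even times, and at odd times the negative drift keeps its mean from
  growing.\<close>

lemma F_inside:
  assumes "valid s" "\<not> (correct s \<and> cur s = card V)"
  shows "(\<Sum>e\<in>E. F j (Suc t) (next_state t e s)) \<le> real (card E) * F j t s"
proof -
  let ?q = "exp (- theta * real (card V)) ^ (j - iter s)"
  have iter: "iter (query_step V E s) = iter s"
  proof (cases "correct s")
    case True
    with assms validD(2)[OF assms(1)] show ?thesis by (auto simp: query_step_null labels_def)
  next
    case False
    with assms query_step_move show ?thesis by (metis select_convs(4) surjective update_convs(2))
  qed
  have i: "iter (next_state t e s) = iter s" for e
    using iter by (simp add: next_state_def evolver_step_def)
  have "(\<Sum>e\<in>E. exp (theta * X (Suc t) (next_state t e s))) \<le> real (card E) * exp (theta * X t s)"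
  proof (cases "odd t")
    case True
    let ?Y = "\<lambda>e. X (Suc t) (evolver_step e (query_step V E s)) - X t s"
    have "(\<Sum>e\<in>E. exp (theta * ?Y e)) \<le> real (card E)"
      by (rule sum_exp_le_card[where b = 6 and \<nu> = "lam / 2"])
         (use X_odd_step[OF assms(1) True assms(2)] theta_bounds in \<open>auto simp: theta_def\<close>)
    then have "exp (theta * X t s) * (\<Sum>e\<in>E. exp (theta * ?Y e)) \<le> exp (theta * X t s) * real (card E)"
      by (intro mult_left_mono) auto
    with True show ?thesis
      by (simp add: next_state_def sum_distrib_left mult_exp_exp algebra_simps)
  next
    case False
    have "(\<Sum>e\<in>E. exp (theta * X (Suc t) (next_state t e s))) \<le> (\<Sum>e\<in>E. exp (theta * X t s))"
      using X_even_step[OF assms(1) _ assms(2)] False theta_bounds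
      by (intro sum_mono) (auto simp: next_state_def)
    then show ?thesis by simp
  qed
  then have "?q * (\<Sum>e\<in>E. exp (theta * X (Suc t) (next_state t e s))) \<le> ?q * (real (card E) * exp (theta * X t s))"
    by (intro mult_left_mono) auto
  then show ?thesis
    unfolding F_def i sum.distrib sum_distrib_left[symmetric] by (simp add: algebra_simps)
qed

text \<open>One step of the affine recursion behind \<open>F\<close>: after exponentiation the
  maximum in \<open>X_boundary\<close> is bounded by a sum. This holds for each edge, not only on
  average.\<close>

lemma F_boundary:
  assumes "valid s" "correct s" "cur s = card V" "e \<in> E" "iter s < j"
  shows "F j (Suc t) (next_state t e s) \<le> F j t s"
proof -
  let ?q = "exp (- theta * real (card V))" and ?A = "exp (theta * (cross_const * real (card V)))"
  let ?X = "X t s" and ?X' = "X (Suc t) (next_state t e s)"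
  obtain r where r: "j - iter s = Suc r" using assms(5) by (metis Suc_diff_Suc)
  have "iter (next_state t e s) = Suc (iter s)"
    using assms(2,3) by (simp add: next_state_def query_step_null evolver_step_def)
  with r have r': "j - iter (next_state t e s) = r" by linarith
  have "exp (theta * ?X') \<le> ?q * exp (theta * ?X) + ?A"
  proof (cases "?X' \<le> ?X - real (card V)")
    case True
    then have "theta * ?X' \<le> theta * (?X - real (card V))"
      using theta_bounds by (intro mult_left_mono) auto
    then have "exp (theta * ?X') \<le> ?q * exp (theta * ?X)"
      by (simp add: mult_exp_exp algebra_simps)
    then show ?thesis by (simp add: add_increasing2)
  next
    case False
    with X_boundary[OF assms(1-4), of t] have "?X' \<le> cross_const * real (card V)" by linarith
    then have "exp (theta * ?X') \<le> ?A" using theta_bounds by simp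
    then show ?thesis by (simp add: add_increasing)
  qed
  then have "?q ^ r * exp (theta * ?X') \<le> ?q ^ r * (?q * exp (theta * ?X) + ?A)"
    by (intro mult_left_mono) auto
  then show ?thesis
    unfolding F_def r r' by (simp add: algebra_simps)
qed

lemma F_step:
  assumes "valid s" "iter s < j"
  shows "(\<Sum>e\<in>E. F j (Suc t) (next_state t e s)) \<le> real (card E) * F j t s"
proof (cases "correct s \<and> cur s = card V")
  case True
  with F_boundary assms have "(\<Sum>e\<in>E. F j (Suc t) (next_state t e s)) \<le> (\<Sum>e\<in>E. F j t s)"
    by (intro sum_mono) auto
  then show ?thesis by simp
next
  case False
  with F_inside assms show ?thesis by blast
qed

end

section \<open>Averaging over the edges picked\<close>

text \<open>An event decided by the first \<open>N\<close> picks is a cylinder over the finite set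
  of prefixes, each of probability \<open>1 / card E ^ N\<close>. Probabilities thus become counts
  of prefixes.\<close>

lemma prob_evolver_space_prefix:
  assumes "finite E" "E \<noteq> {}"
    and Q: "\<And>\<omega>. \<omega> \<in> space (evolver_space E) \<Longrightarrow> Q \<omega> \<longleftrightarrow> Q (restrict \<omega> {..<N})"
  shows "\<P>(\<omega> in evolver_space E. Q \<omega>) =
    real (card {p \<in> {..<N} \<rightarrow>\<^sub>E E. Q p}) / real (card E) ^ N"
proof -
  let ?M = "\<lambda>_ :: nat. uniform_count_measure E" and ?J = "{..<N}"
  interpret product_prob_space ?M UNIV
    using assms
    by (auto simp: product_prob_space_def product_prob_space_axioms_def product_sigma_finite_def
        intro!: prob_space_uniform_count_measure prob_space_imp_sigma_finite)
  interpret J: finite_product_prob_space ?M ?J by unfold_locales simp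
  let ?A = "{p \<in> ?J \<rightarrow>\<^sub>E E. Q p}"
  have fin: "finite ?A" using assms(1) by (simp add: finite_PiE)
  have single: "{p} \<in> sets (Pi\<^sub>M ?J ?M)" "measure (Pi\<^sub>M ?J ?M) {p} = (1 / real (card E)) ^ N"
    if "p \<in> ?A" for p
  proof -
    have p: "{p} = (\<Pi>\<^sub>E i\<in>?J. {p i})" "\<And>i. i \<in> ?J \<Longrightarrow> {p i} \<subseteq> E"
      using that by (auto simp: PiE_def PiE_singleton[of p ?J, unfolded PiE_def])
    then show "{p} \<in> sets (Pi\<^sub>M ?J ?M)"
      by (subst p(1), intro sets_PiM_I_finite) (auto simp: sets_uniform_count_measure)
    have "measure (Pi\<^sub>M ?J ?M) (\<Pi>\<^sub>E i\<in>?J. {p i}) = (\<Prod>i\<in>?J. measure (uniform_count_measure E) {p i})"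
      using p(2) by (intro J.finite_measure_PiM_emb) (auto simp: sets_uniform_count_measure)
    also have "\<dots> = (\<Prod>i\<in>?J. 1 / real (card E))"
      using p(2) assms(1) by (intro prod.cong) (auto simp: measure_uniform_count_measure)
    finally show "measure (Pi\<^sub>M ?J ?M) {p} = (1 / real (card E)) ^ N"
      unfolding p(1)[symmetric] by simp
  qed
  have A: "?A \<in> sets (Pi\<^sub>M ?J ?M)"
    using sets.finite_UN[OF fin, of "\<lambda>p. {p}"] single(1) by simp
  have "{\<omega> \<in> space (evolver_space E). Q \<omega>} = prod_emb UNIV ?M ?J ?A"
    using Q by (auto simp: prod_emb_def evolver_space_def space_PiM space_uniform_count_measure)
  then have "\<P>(\<omega> in evolver_space E. Q \<omega>) = measure (Pi\<^sub>M ?J ?M) ?A"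
    using emeasure_PiM_emb'[OF subset_UNIV _ A] by (simp add: measure_def evolver_space_def)
  also have "\<dots> = (\<Sum>p\<in>?A. measure (Pi\<^sub>M ?J ?M) {p})"
    using J.finite_measure_eq_sum_singleton[OF fin] single(1) by simp
  also have "\<dots> = (\<Sum>p\<in>?A. (1 / real (card E)) ^ N)"
    by (rule sum.cong[OF refl single(2)])
  also have "\<dots> = real (card ?A) / real (card E) ^ N"
    by (simp add: power_one_over)
  finally show ?thesis .
qed

lemma sum_PiE_lessThan_Suc:
  fixes f :: "(nat \<Rightarrow> 'a) \<Rightarrow> real"
  shows "(\<Sum>p\<in>{..<Suc k} \<rightarrow>\<^sub>E E. f p) = (\<Sum>p\<in>{..<k} \<rightarrow>\<^sub>E E. \<Sum>e\<in>E. f (p(k := e)))"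
proof -
  have inj: "inj_on (\<lambda>(y, g). g(k := y)) (E \<times> ({..<k} \<rightarrow>\<^sub>E E))"
    by (rule inj_combinator) simp
  have "(\<Sum>p\<in>{..<Suc k} \<rightarrow>\<^sub>E E. f p) = (\<Sum>(e, p)\<in>E \<times> ({..<k} \<rightarrow>\<^sub>E E). f (p(k := e)))"
    unfolding lessThan_Suc PiE_insert_eq sum.reindex[OF inj] by (simp add: case_prod_unfold)
  also have "\<dots> = (\<Sum>e\<in>E. \<Sum>p\<in>{..<k} \<rightarrow>\<^sub>E E. f (p(k := e)))"
    by (rule sum.cartesian_product[symmetric])
  also have "\<dots> = (\<Sum>p\<in>{..<k} \<rightarrow>\<^sub>E E. \<Sum>e\<in>E. f (p(k := e)))"
    by (rule sum.swap)
  finally show ?thesis .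
qed

text \<open>Divided by \<open>card E ^ N\<close>, this bounds the expectation of a supermartingale
  by its initial value; \<open>\<lambda>_. undefined\<close> is the only prefix of length
  \<open>0\<close>.\<close>

lemma sum_PiE_supermartingale:
  fixes g :: "nat \<Rightarrow> (nat \<Rightarrow> 'a) \<Rightarrow> real"
  assumes "\<And>k p. p \<in> {..<k} \<rightarrow>\<^sub>E E \<Longrightarrow> (\<Sum>e\<in>E. g (Suc k) (p(k := e))) \<le> real (card E) * g k p"
  shows "(\<Sum>p\<in>{..<N} \<rightarrow>\<^sub>E E. g N p) \<le> real (card E) ^ N * g 0 (\<lambda>_. undefined)"
proof (induction N)
  case 0
  then show ?case by simp
next
  case (Suc N)
  have "(\<Sum>p\<in>{..<Suc N} \<rightarrow>\<^sub>E E. g (Suc N) p) \<le> (\<Sum>p\<in>{..<N} \<rightarrow>\<^sub>E E. real (card E) * g N p)"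
    unfolding sum_PiE_lessThan_Suc by (intro sum_mono assms)
  also have "\<dots> \<le> real (card E) * (real (card E) ^ N * g 0 (\<lambda>_. undefined))"
    unfolding sum_distrib_left[symmetric] using Suc.IH by (intro mult_left_mono) auto
  finally show ?case by (simp add: mult.assoc)
qed

section \<open>The process stopped at an iteration\<close>

context tracking
begin

lemma run_Suc: "run V E 2 s0 \<omega> (Suc t) = next_state t (\<omega> (t div 2)) (run V E 2 s0 \<omega> t)"
  by (auto simp: Let_def next_state_def elim!: oddE)

declare run.simps(2) [simp del] run_Suc [simp]

lemma run_cong:
  "(\<And>i. i < t div 2 \<Longrightarrow> \<omega> i = \<omega>' i) \<Longrightarrow> run V E 2 s0 \<omega> t = run V E 2 s0 \<omega>' t"
proof (induction t)
  case (Suc t)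
  have "run V E 2 s0 \<omega> t = run V E 2 s0 \<omega>' t"
    by (rule Suc.IH) (use Suc.prems in auto)
  moreover have "odd t \<Longrightarrow> \<omega> (t div 2) = \<omega>' (t div 2)"
    by (rule Suc.prems) (auto elim!: oddE)
  ultimately show ?case by (simp add: next_state_def)
qed simp

lemma valid_next_state: "valid s \<Longrightarrow> (odd t \<Longrightarrow> e \<in> E) \<Longrightarrow> valid (next_state t e s)"
  by (simp add: next_state_def valid_query_step valid_evolver_step)

lemma valid_run:
  assumes "valid s0"
  shows "(\<And>i. i < t div 2 \<Longrightarrow> \<omega> i \<in> E) \<Longrightarrow> valid (run V E 2 s0 \<omega> t)"
proof (induction t)
  case (Suc t)
  have "valid (run V E 2 s0 \<omega> t)"
    by (rule Suc.IH) (use Suc.prems in auto)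
  moreover have "odd t \<Longrightarrow> \<omega> (t div 2) \<in> E"
    by (rule Suc.prems) (auto elim!: oddE)
  ultimately show ?case by (simp add: valid_next_state)
qed (use assms in simp)

lemma iter_next_state: "iter s \<le> iter (next_state t e s)" "iter (next_state t e s) \<le> Suc (iter s)"
  by (auto simp: next_state_def query_step_def evolver_step_def split: option.split)

lemma iter_run_mono: "t \<le> t' \<Longrightarrow> iter (run V E 2 s0 \<omega> t) \<le> iter (run V E 2 s0 \<omega> t')"
  by (rule lift_Suc_mono_le[where f = "\<lambda>t. iter (run V E 2 s0 \<omega> t)"]) (simp_all add: iter_next_state)

text \<open>\<open>iter\<close> grows by at most one per time unit, so the first time at which it is
  at least \<open>j\<close> is also the first at which it equals \<open>j\<close>.\<close>

lemma iteration_start_props: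
  assumes "iter s0 < j" "j \<le> iter (run V E 2 s0 \<omega> T)"
  defines "\<tau> \<equiv> iteration_start V E 2 s0 \<omega> j"
  shows "\<tau> \<le> T" "iter (run V E 2 s0 \<omega> \<tau>) = j" "t < \<tau> \<Longrightarrow> iter (run V E 2 s0 \<omega> t) < j"
proof -
  let ?i = "\<lambda>t. iter (run V E 2 s0 \<omega> t)"
  define u where "u = (LEAST t. j \<le> ?i t)"
  have u: "j \<le> ?i u" "u \<le> T" "t < u \<Longrightarrow> ?i t < j" for t
    unfolding u_def using assms(2) by (auto intro: LeastI Least_le dest: not_less_Least)
  obtain v where v: "u = Suc v" using u(1) assms(1) by (cases u) auto
  have uj: "?i u = j"
    using u(1) u(3)[of v]
      iter_next_state(2)[where t = v and e = "\<omega> (v div 2)" and s = "run V E 2 s0 \<omega> v"]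
    by (simp add: v)
  have "\<tau> = u"
    unfolding \<tau>_def iteration_start_def
    by (rule Least_equality) (use uj u(3) in \<open>auto simp: not_less[symmetric]\<close>)
  with uj u(2,3) show "\<tau> \<le> T" "?i \<tau> = j" "t < \<tau> \<Longrightarrow> ?i t < j" by auto
qed

section \<open>A uniform bound on the starting time of an iteration\<close>

text \<open>Two moves in a row outrun the single swap, so this measure grows with every pair of queries, which
  bounds the time at which iteration \<open>j\<close> starts uniformly in the edges picked.\<close>

definition progress :: "'v state \<Rightarrow> real" where
  "progress s = real (iter s * card V + cur s) * (real (card V) + 1) - real (d (truth s (cur s)) (hyp s (cur s)))"

text \<open>A null answer raises the first term by at least \<open>card V + 1\<close>, more than the
  new distance can take away. Without one, the two moves lower the distance by two and the swap
  raises it by at most one.\<close>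

lemma progress_pair:
  assumes "valid s" "even t" "e \<in> E"
  shows "progress s + 1 \<le> progress (next_state (Suc t) e (next_state t e' s))"
proof -
  let ?p = "\<lambda>s. iter s * card V + cur s" and ?d = "\<lambda>s. d (truth s (cur s)) (hyp s (cur s))"
  define s1 where "s1 = query_step V E s"
  define s2 where "s2 = query_step V E s1"
  define s3 where "s3 = evolver_step e s2"
  have v: "valid s1" "valid s2" "valid s3"
    using assms valid_query_step valid_evolver_step by (auto simp: s1_def s2_def s3_def)
  \<comment> \<open>This includes the end of an iteration, where \<open>cur\<close> falls from
    \<open>card V\<close> to \<open>1\<close> while \<open>iter\<close> grows by one.\<close>
  have null: "?p (query_step V E s) = ?p s + 1" if "valid s" "correct s" for s
    using that by (auto simp: query_step_null valid_def labels_def)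
  have move: "?p (query_step V E s) = ?p s \<and> ?d s = Suc (?d (query_step V E s))"
    if "valid s" "\<not> correct s" for s
  proof -
    from that obtain v where "query_step V E s = s\<lparr>hyp := (hyp s)(cur s := v)\<rparr>"
        "d (truth s (cur s)) (hyp s (cur s)) = Suc (d (truth s (cur s)) v)"
      by (rule query_step_move)
    then show ?thesis by simp
  qed
  have mono: "?p s \<le> ?p (query_step V E s)" if "valid s" for s
    using null[OF that] move[OF that] by (cases "correct s") auto
  have p3: "?p s3 = ?p s2" by (simp add: s3_def evolver_step_def)
  have "progress s + 1 \<le> progress s3"
  proof (cases "correct s \<or> correct s1")
    case True
    have "?p s + 1 \<le> ?p s2"
    proof (cases "correct s")
      case True
      then show ?thesis using null[OF assms(1)] mono[OF v(1)] by (simp add: s1_def s2_def)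
    next
      case False
      with True have "correct s1" by simp
      then show ?thesis using null[OF v(1)] mono[OF assms(1)] by (simp add: s1_def s2_def)
    qed
    then have "real (?p s) + 1 \<le> real (?p s3)" unfolding p3 by linarith
    then have "(real (?p s) + 1) * (real (card V) + 1) \<le> real (?p s3) * (real (card V) + 1)"
      by (intro mult_right_mono) auto
    moreover have "real (?d s3) < real (card V)" using d_less_card validD[OF v(3)] by simp
    moreover have "0 \<le> real (?d s)" by simp
    ultimately show ?thesis
      unfolding progress_def distrib_right[of "real (?p s)"] mult_1_left by linarith
  next
    case False
    have "?p s2 = ?p s" "?d s = Suc (Suc (?d s2))"
      using move[OF assms(1)] move[OF v(1)] False by (auto simp: s1_def s2_def)
    moreover have "?d s3 \<le> ?d s2 + 1"
      using d_other(1)[OF assms(3)] validD[OF v(2)]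
      by (auto simp: s3_def evolver_step_def swap_labels_def)
    ultimately show ?thesis unfolding progress_def p3 by simp
  qed
  with assms(2) show ?thesis by (simp add: next_state_def s1_def s2_def s3_def)
qed

lemma progress_run:
  assumes "valid s0"
  shows "(\<And>i. i < k \<Longrightarrow> \<omega> i \<in> E) \<Longrightarrow> progress s0 + real k \<le> progress (run V E 2 s0 \<omega> (2 * k))"
proof (induction k)
  case (Suc k)
  have "valid (run V E 2 s0 \<omega> (2 * k))" using Suc.prems by (intro valid_run assms) auto
  from progress_pair[OF this _ Suc.prems[of k], of "2 * k" "\<omega> k"] Suc.IH Suc.prems
  show ?case by fastforce
qed simp

text \<open>Counted in pairs of queries, that is in swaps. Before iteration \<open>j\<close> starts,
  \<open>progress\<close> cannot exceed this value, while every pair adds at least \<open>1\<close>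
  to its positive initial value.\<close>

definition horizon :: "nat \<Rightarrow> nat" where
  "horizon j = (j * card V + card V) * (card V + 1)"

lemma iteration_reached:
  assumes "valid s0" "1 \<le> iter s0" "\<And>i. i < horizon j \<Longrightarrow> \<omega> i \<in> E"
  shows "j \<le> iter (run V E 2 s0 \<omega> (2 * horizon j))"
proof (rule ccontr)
  let ?s = "run V E 2 s0 \<omega> (2 * horizon j)" and ?n = "card V"
  assume "\<not> ?thesis"
  then have i: "iter ?s + 1 \<le> j" by simp
  have "valid ?s" using assms by (intro valid_run) auto
  then have "cur ?s \<le> ?n" by (simp add: valid_def labels_def)
  with i have "iter ?s * ?n + cur ?s \<le> j * ?n"
    using mult_le_mono1[OF i, of ?n] by simp
  then have "(iter ?s * ?n + cur ?s) * (?n + 1) \<le> (j * ?n) * (?n + 1)" by (rule mult_le_mono1)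
  also have "\<dots> \<le> horizon j" unfolding horizon_def by (intro mult_le_mono1) simp
  finally have "real ((iter ?s * ?n + cur ?s) * (?n + 1)) \<le> real (horizon j)" by (rule of_nat_mono)
  then have "progress ?s \<le> real (horizon j)" by (simp add: progress_def algebra_simps)
  moreover have "progress s0 > 0"
  proof -
    have "1 \<le> iter s0 * ?n + cur s0" using assms(1) by (simp add: valid_def labels_def)
    then have "1 * (real ?n + 1) \<le> real (iter s0 * ?n + cur s0) * (real ?n + 1)"
      by (intro mult_right_mono) linarith+
    moreover have "real (d (truth s0 (cur s0)) (hyp s0 (cur s0))) < 1 * (real ?n + 1)"
      using d_less_card[of "truth s0 (cur s0)" "hyp s0 (cur s0)"] validD[OF assms(1)] by simp
    ultimately show ?thesis unfolding progress_def diff_gt_0_iff_gt by (rule less_le_trans[rotated])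
  qed
  ultimately show False using progress_run[OF assms(1,3)] by fastforce
qed

section \<open>The supermartingale frozen when iteration \<open>j\<close> starts\<close>

primrec stopped :: "nat \<Rightarrow> 'v state \<Rightarrow> (nat \<Rightarrow> 'v set) \<Rightarrow> nat \<Rightarrow> real" where
  "stopped j s0 \<omega> 0 = F j 0 s0"
| "stopped j s0 \<omega> (Suc t) =
     (if iter (run V E 2 s0 \<omega> t) < j then F j (Suc t) (run V E 2 s0 \<omega> (Suc t)) else stopped j s0 \<omega> t)"

lemma stopped_cong:
  "(\<And>i. i < t div 2 \<Longrightarrow> \<omega> i = \<omega>' i) \<Longrightarrow> stopped j s0 \<omega> t = stopped j s0 \<omega>' t"
proof (induction t)
  case (Suc t)
  have "stopped j s0 \<omega> t = stopped j s0 \<omega>' t"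
    by (rule Suc.IH) (use Suc.prems in auto)
  moreover have "run V E 2 s0 \<omega> t = run V E 2 s0 \<omega>' t"
    by (rule run_cong) (use Suc.prems in auto)
  moreover have "run V E 2 s0 \<omega> (Suc t) = run V E 2 s0 \<omega>' (Suc t)"
    by (rule run_cong) (use Suc.prems in auto)
  ultimately show ?case by (simp del: run_Suc)
qed simp

lemma stopped_eq_F:
  "iter (run V E 2 s0 \<omega> t) < j \<Longrightarrow> stopped j s0 \<omega> t = F j t (run V E 2 s0 \<omega> t)"
  using iter_next_state(1) by (cases t) (auto intro: le_less_trans)

lemma F_nonneg: "F j t s \<ge> 0"
  by (simp add: F_def sum_nonneg)

lemma stopped_nonneg: "stopped j s0 \<omega> t \<ge> 0"
  by (induction t) (simp_all add: F_nonneg)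

lemma E_pos: "0 < card E"
  using E_nonempty[OF card_V] finite_E by (simp add: card_gt_0_iff)

text \<open>A pair of time units matches one pick: the run up to and including the second query is
  determined by the picks before \<open>k\<close>, and pick \<open>k\<close> is used only in the
  swap that follows.\<close>

lemma stopped_pair:
  assumes "valid s0" "p \<in> {..<k} \<rightarrow>\<^sub>E E"
  shows "(\<Sum>e\<in>E. stopped j s0 (p(k := e)) (2 * Suc k)) \<le> real (card E) * stopped j s0 p (2 * k)"
proof -
  let ?r = "run V E 2 s0 p" and ?t = "Suc (2 * k)"
  have run: "run V E 2 s0 (p(k := e)) t = ?r t" "stopped j s0 (p(k := e)) t = stopped j s0 p t"
    if "t \<le> ?t" for e t
  proof -
    have "(p(k := e)) i = p i" if "i < t div 2" for i
    proof -
      have "i < k" using that \<open>t \<le> ?t\<close> by linarith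
      then show ?thesis by simp
    qed
    then show "run V E 2 s0 (p(k := e)) t = ?r t" "stopped j s0 (p(k := e)) t = stopped j s0 p t"
      by (auto intro: run_cong stopped_cong)
  qed
  have v: "valid (?r t)" if "t \<le> ?t" for t
    using assms that by (intro valid_run) auto
  have 1: "stopped j s0 p ?t \<le> stopped j s0 p (2 * k)"
  proof (cases "iter (?r (2 * k)) < j")
    case True
    \<comment> \<open>No swap follows the first query, so all summands in \<open>F_step\<close> are
      equal and \<open>card E\<close> cancels.\<close>
    have "real (card E) * F j ?t (?r ?t) \<le> real (card E) * F j (2 * k) (?r (2 * k))"
      using F_step[OF v True, of "2 * k"] by (simp add: next_state_def)
    then have "F j ?t (?r ?t) \<le> F j (2 * k) (?r (2 * k))"
      using E_pos by (simp del: run_Suc)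
    then show ?thesis using True stopped_eq_F[OF True] by (simp del: run_Suc)
  qed simp
  have 2: "(\<Sum>e\<in>E. stopped j s0 (p(k := e)) (Suc ?t)) \<le> real (card E) * stopped j s0 p ?t"
  proof (cases "iter (?r ?t) < j")
    case True
    have "stopped j s0 (p(k := e)) (Suc ?t) = F j (Suc ?t) (next_state ?t e (?r ?t))" for e
      unfolding stopped.simps(2)[of _ _ _ ?t] run_Suc[of _ _ ?t] run(1)[OF order_refl] using True by simp
    then show ?thesis using F_step[OF v True, of ?t] stopped_eq_F[OF True] by (simp only: order_refl)
  next
    case False
    then have "stopped j s0 (p(k := e)) (Suc ?t) = stopped j s0 p ?t" for e
      unfolding stopped.simps(2)[of _ _ _ ?t] run[OF order_refl] by simp
    then show ?thesis by simp
  qed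
  have "(\<Sum>e\<in>E. stopped j s0 (p(k := e)) (Suc ?t)) \<le> real (card E) * stopped j s0 p (2 * k)"
    using 2 1 by (meson mult_left_mono of_nat_0_le_iff order_trans)
  then show ?thesis by (simp only: mult_Suc_right add_2_eq_Suc)
qed

text \<open>Turns a bound on the potential back into one on the distance: \<open>eta * U\<close>
  takes away at most a sixteenth of \<open>D\<close>, and the terms of \<open>X\<close> besides
  \<open>Phi\<close> and \<open>U\<close> are nonnegative.\<close>

lemma X_ge:
  assumes "valid s" shows "D s / 2 \<le> X t s"
proof -
  have "U s \<le> D s"
    unfolding U_def D_def total_dist_def of_nat_sum
    by (rule sum_mono2) (use validD(2)[OF assms] in \<open>auto simp: labels_def\<close>)
  then have "eta * U s \<le> 1 / 16 * D s"
    using eta_bounds D_nonneg[of s] by (intro mult_mono) (auto simp: U_def intro: sum_nonneg)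
  moreover have "real (cur s) \<le> real (card V)" using validD(2)[OF assms] by (auto simp: labels_def)
  ultimately show ?thesis
    using Phi_ge[of s] lam_bounds eta_bounds D_nonneg[of s] by (auto simp: X_def Psi_def)
qed

text \<open>\<open>stopped\<close> keeps the value of \<open>F\<close> at the start of iteration
  \<open>j\<close>. There the exponent \<open>j - iter\<close> is \<open>0\<close> and the sum is
  empty, so this value is \<open>exp (theta * X)\<close>.\<close>

lemma stopped_ge:
  assumes "valid s0" "iter s0 < j" "j \<le> iter (run V E 2 s0 \<omega> T)" "\<And>i. i < T div 2 \<Longrightarrow> \<omega> i \<in> E"
  shows "exp (theta * real (dist_at_iteration V E 2 s0 \<omega> j) / 2) \<le> stopped j s0 \<omega> T"
proof -
  define \<tau> where "\<tau> = iteration_start V E 2 s0 \<omega> j"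
  note \<tau> = iteration_start_props[OF assms(2,3), folded \<tau>_def]
  let ?r = "run V E 2 s0 \<omega>"
  have "stopped j s0 \<omega> t = F j \<tau> (?r \<tau>)" if "\<tau> \<le> t" for t
    using that
  proof (induction t rule: dec_induct)
    case base
    obtain u where "\<tau> = Suc u" using \<tau>(2) assms(2) by (cases \<tau>) auto
    with \<tau>(3)[of u] show ?case by simp
  next
    case (step t)
    have "\<not> iter (?r t) < j" using iter_run_mono[OF step.hyps(1), of s0 \<omega>] \<tau>(2) by simp
    with step.IH show ?case by simp
  qed
  with \<tau>(1) have "stopped j s0 \<omega> T = exp (theta * X \<tau> (?r \<tau>))"
    by (simp add: F_def \<tau>(2))
  moreover have "valid (?r \<tau>)"
    using assms(4) \<tau>(1) by (intro valid_run assms(1)) (meson div_le_mono less_le_trans)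
  then have "D (?r \<tau>) / 2 \<le> X \<tau> (?r \<tau>)" by (rule X_ge)
  moreover have "D (?r \<tau>) = real (dist_at_iteration V E 2 s0 \<omega> j)"
    by (simp add: D_def dist_at_iteration_def Let_def \<tau>_def)
  ultimately show ?thesis using theta_bounds by (simp add: field_simps)
qed

section \<open>Initial value and Markov's inequality\<close>

definition start_const :: real where
  "start_const = theta * cross_const + ln (1 + 1 / (1 - exp (- theta)))"

text \<open>The initial potential is at most \<open>card V * (card V + 2)\<close>, and
  \<open>F\<close> credits \<open>card V\<close> for each of the \<open>j - 1\<close> boundaries
  ahead, so for \<open>j > card V + 2\<close> its first summand is at most \<open>1\<close>. The
  rest is a geometric sum, whose bound enters \<open>start_const\<close> as a logarithm.\<close>

lemma F_init:
  assumes "valid s0" "iter s0 = 1" "cur s0 = 1" "card V + 2 < j"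
  shows "F j 0 s0 \<le> exp (start_const * real (card V))"
proof -
  let ?n = "real (card V)"
  define q where "q = exp (- theta * ?n)"
  define K where "K = 1 / (1 - exp (- theta))"
  have n: "?n \<ge> 2" using card_V by simp
  have K: "K \<ge> 0" using theta_bounds by (simp add: K_def)
  have c: "0 \<le> theta * (cross_const * ?n)"
    using theta_bounds eta_bounds by (simp add: cross_const_def)
  have "exp (- theta * ?n) \<le> exp (- theta)" using n theta_bounds by simp
  then have q: "0 < q" "q < 1" "q \<le> exp (- theta)"
    using n theta_bounds by (auto simp: q_def)
  have "(\<Sum>i<j - 1. q ^ i) = (1 - q ^ (j - 1)) / (1 - q)"
    using q by (simp add: sum_gp_strict)
  also have "\<dots> \<le> 1 / (1 - q)" using q by (intro divide_right_mono) auto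
  also have "\<dots> \<le> K" unfolding K_def using q theta_bounds by (intro divide_left_mono) auto
  finally have sum: "(\<Sum>i<j - 1. q ^ i) \<le> K" .
  have "X 0 s0 \<le> ?n * real (j - 1)"
  proof -
    have "X 0 s0 \<le> Phi s0 + ?n"
      using D_nonneg[of s0] eta_bounds by (simp add: X_def Psi_start[OF assms(3)])
    also have "\<dots> \<le> ?n\<^sup>2 + lam * ?n + ?n"
      using Phi_le[of s0] D_le[OF assms(1)] by linarith
    also have "\<dots> \<le> ?n\<^sup>2 + 1 * ?n + ?n"
      using lam_bounds n by (intro add_mono mult_right_mono) auto
    also have "\<dots> = ?n * (?n + 2)" by (simp add: power2_eq_square algebra_simps)
    also have "\<dots> \<le> ?n * real (j - 1)" using assms(4) by (intro mult_left_mono) auto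
    finally show ?thesis .
  qed
  then have "theta * X 0 s0 \<le> theta * (?n * real (j - 1))"
    using theta_bounds by (intro mult_left_mono) auto
  then have "q ^ (j - 1) * exp (theta * X 0 s0) \<le> 1"
    unfolding q_def exp_of_nat_mult[symmetric] mult_exp_exp by (simp add: algebra_simps)
  then have "F j 0 s0 \<le> 1 + exp (theta * (cross_const * ?n)) * K"
    unfolding F_def assms(2) q_def[symmetric] using sum by (intro add_mono mult_left_mono) auto
  also have "\<dots> \<le> exp (theta * (cross_const * ?n)) * (1 + K)"
    using c by (simp add: distrib_left)
  also have "\<dots> = exp (theta * cross_const * ?n + ln (1 + K))"
    using K by (simp add: exp_add mult.assoc)
  also have "\<dots> \<le> exp (theta * cross_const * ?n + ln (1 + K) * ?n)"
    using K n mult_left_mono[of 1 ?n "ln (1 + K)"] by simp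
  finally show ?thesis by (simp add: start_const_def K_def algebra_simps)
qed

text \<open>Markov's inequality by counting: every prefix of \<open>horizon j\<close> picks with too
  large a distance contributes at least \<open>exp (theta * C * card V / 2)\<close> to the sum of
  \<open>stopped\<close>, which is at most the number of prefixes times the initial value.\<close>

lemma prob_dist_at_iteration:
  assumes "valid s0" "iter s0 = 1" "cur s0 = 1" "card V + 2 < j"
  shows "\<P>(\<omega> in evolver_space E. real (dist_at_iteration V E 2 s0 \<omega> j) \<le> C * real (card V))
    \<ge> 1 - exp ((start_const - theta * C / 2) * real (card V))"
proof -
  let ?n = "real (card V)"
  define N where "N = horizon j"
  define P where "P = ({..<N} \<rightarrow>\<^sub>E E)"
  define Q where "Q = (\<lambda>\<omega>. real (dist_at_iteration V E 2 s0 \<omega> j) \<le> C * ?n)"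
  have reach: "j \<le> iter (run V E 2 s0 \<omega> (2 * N))" if "\<And>i. i < N \<Longrightarrow> \<omega> i \<in> E" for \<omega>
    using iteration_reached[of s0 j \<omega>] assms that by (simp add: N_def)
  \<comment> \<open>Both runs agree up to time \<open>2 * N\<close>, and in each iteration
    \<open>j\<close> has started by then, so the first \<open>N\<close> picks decide the
    event.\<close>
  have "Q \<omega> \<longleftrightarrow> Q (restrict \<omega> {..<N})" if "\<omega> \<in> space (evolver_space E)" for \<omega>
  proof -
    let ?p = "restrict \<omega> {..<N}"
    have E: "\<omega> i \<in> E" for i
      using that by (auto simp: evolver_space_def space_PiM space_uniform_count_measure)
    have eq: "run V E 2 s0 \<omega> t = run V E 2 s0 ?p t" if "t \<le> 2 * N" for t
      using that by (intro run_cong) auto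
    have j: "iter s0 < j" using assms by simp
    define \<tau> \<tau>' where "\<tau> = iteration_start V E 2 s0 \<omega> j" and "\<tau>' = iteration_start V E 2 s0 ?p j"
    note \<tau> = iteration_start_props[OF j reach[of \<omega>, OF E], folded \<tau>_def]
    have "j \<le> iter (run V E 2 s0 ?p (2 * N))" using E by (intro reach) simp
    note \<tau>' = iteration_start_props[OF j this, folded \<tau>'_def]
    have "\<tau> = \<tau>'"
    proof (rule antisym; rule leI; rule notI)
      assume "\<tau>' < \<tau>"
      with \<tau>(3)[of \<tau>'] \<tau>'(2) eq[OF \<tau>'(1)] show False by simp
    next
      assume "\<tau> < \<tau>'"
      with \<tau>'(3)[of \<tau>] \<tau>(2) eq[OF \<tau>(1)] show False by simp
    qed
    then show ?thesis
      using eq[OF \<tau>(1)] by (simp add: Q_def dist_at_iteration_def Let_def \<tau>_def \<tau>'_def)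
  qed
  then have 1: "\<P>(\<omega> in evolver_space E. Q \<omega>) = real (card {p \<in> P. Q p}) / real (card E) ^ N"
    unfolding P_def using finite_E E_nonempty[OF card_V] by (intro prob_evolver_space_prefix) auto
  have 2: "real (card {p \<in> P. \<not> Q p}) \<le>
    real (card E) ^ N * exp ((start_const - theta * C / 2) * ?n)"
  proof -
    have finP: "finite P" unfolding P_def using finite_E by (simp add: finite_PiE)
    have "exp (theta * (C * ?n) / 2) \<le> stopped j s0 p (2 * N)" if "p \<in> {p \<in> P. \<not> Q p}" for p
    proof -
      have p: "i < N \<Longrightarrow> p i \<in> E" for i using that by (auto simp: P_def)
      have "theta * (C * ?n) \<le> theta * real (dist_at_iteration V E 2 s0 p j)"
        using that theta_bounds by (intro mult_left_mono) (auto simp: Q_def)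
      then have "exp (theta * (C * ?n) / 2) \<le> exp (theta * real (dist_at_iteration V E 2 s0 p j) / 2)"
        by simp
      also have "\<dots> \<le> stopped j s0 p (2 * N)"
        using assms p by (intro stopped_ge reach) auto
      finally show ?thesis .
    qed
    then have "real (card {p \<in> P. \<not> Q p}) * exp (theta * (C * ?n) / 2) \<le>
        (\<Sum>p\<in>{p \<in> P. \<not> Q p}. stopped j s0 p (2 * N))"
      by (rule sum_bounded_below)
    also have "\<dots> \<le> (\<Sum>p\<in>P. stopped j s0 p (2 * N))"
      using finP stopped_nonneg by (intro sum_mono2) auto
    also have "\<dots> \<le> real (card E) ^ N * stopped j s0 (\<lambda>_. undefined) (2 * 0)"
      unfolding P_def
      by (rule sum_PiE_supermartingale[where g = "\<lambda>k p. stopped j s0 p (2 * k)"])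
         (rule stopped_pair[OF assms(1)])
    also have "\<dots> \<le> real (card E) ^ N * exp (start_const * ?n)"
      using F_init[OF assms] by (intro mult_left_mono) auto
    finally have "real (card {p \<in> P. \<not> Q p}) \<le>
        real (card E) ^ N * exp (start_const * ?n) / exp (theta * (C * ?n) / 2)"
      by (simp add: pos_le_divide_eq)
    also have "\<dots> = real (card E) ^ N * exp ((start_const - theta * C / 2) * ?n)"
      by (simp add: exp_diff algebra_simps)
    finally show ?thesis .
  qed
  have 3: "real (card {p \<in> P. Q p}) + real (card {p \<in> P. \<not> Q p}) = real (card E) ^ N"
  proof -
    have "finite P" unfolding P_def using finite_E by (simp add: finite_PiE)
    then have "card {p \<in> P. Q p} + card {p \<in> P. \<not> Q p} = card P"
      by (subst card_Un_disjoint[symmetric]) (auto intro: arg_cong[where f = card])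
    also have "\<dots> = card E ^ N" by (simp add: P_def card_PiE)
    finally have "real (card {p \<in> P. Q p} + card {p \<in> P. \<not> Q p}) = real (card E ^ N)"
      by (rule arg_cong)
    then show ?thesis by simp
  qed
  have "0 < real (card E) ^ N" using E_pos by simp
  moreover have "1 - x \<le> y" if "y = a / M" "b \<le> M * x" "a + b = M" "M > 0" for a b x y M :: real
  proof -
    have "M * 1 \<le> M * (x + y)" using that by (simp add: distrib_left)
    with that(4) show ?thesis by (simp only: mult_le_cancel_left_pos)
  qed
  ultimately have "1 - exp ((start_const - theta * C / 2) * ?n) \<le> \<P>(\<omega> in evolver_space E. Q \<omega>)"
    using 1 2 3 by blast
  then show ?thesis unfolding Q_def .
qed

end

theorem theorem7:
  fixes \<Delta> :: nat
  shows "\<exists>z :: nat \<Rightarrow> nat. \<forall>a :: real. a > 0 \<longrightarrow> (\<exists>C :: real. \<forall>n :: nat. n \<ge> 2 \<longrightarrow>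
    (\<forall>(V :: 'v set) (E :: 'v set set) (M\<^sub>T :: nat \<Rightarrow> 'v) (M\<^sub>H :: nat \<Rightarrow> 'v).
       is_tree V E \<longrightarrow> card V = n \<longrightarrow> max_degree V E \<le> \<Delta> \<longrightarrow>
       bij_betw M\<^sub>T (labels V) V \<longrightarrow> M\<^sub>H \<in> labels V \<rightarrow> V \<longrightarrow>
       (\<forall>j > z n.
          \<P>(\<omega> in evolver_space E.
               real (dist_at_iteration V E 2 (init_state M\<^sub>T M\<^sub>H) \<omega> j) \<le> C * real n)
            \<ge> 1 - real n powr (- a))))"
proof -
  \<comment> \<open>Both constants depend on \<open>\<Delta>\<close> only, so \<open>C\<close> can
    be fixed before the tree is given.\<close>
  define \<theta> where "\<theta> = tracking.theta \<Delta>"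
  define c where "c = tracking.start_const \<Delta>"
  \<comment> \<open>\<open>C = 2 * (a + c) / \<theta>\<close> makes the rate
    \<open>c - \<theta> * C / 2\<close> equal to \<open>- a\<close>. The failure probability is then
    at most \<open>exp (- a * n)\<close>, which \<open>ln n \<le> n\<close> weakens to the
    polynomial bound.\<close>
  have "1 - real n powr (- a) \<le> \<P>(\<omega> in evolver_space E.
      real (dist_at_iteration V E 2 (init_state M\<^sub>T M\<^sub>H) \<omega> j) \<le> (2 * (a + c) / \<theta>) * real n)"
    if "a > 0" "n \<ge> 2" "is_tree V E" "card V = n" "max_degree V E \<le> \<Delta>"
      "bij_betw M\<^sub>T (labels V) V" "M\<^sub>H \<in> labels V \<rightarrow> V" "n + 2 < j"
    for a n j and V :: "'v set" and E M\<^sub>T M\<^sub>H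
  proof -
    interpret tracking V E \<Delta>
      using that by unfold_locales auto
    let ?s = "init_state M\<^sub>T M\<^sub>H"
    have "valid ?s" "iter ?s = 1" "cur ?s = 1"
      using that by (auto simp: valid_def init_state_def labels_def)
    from prob_dist_at_iteration[OF this, of j "2 * (a + c) / \<theta>"] that
    have "1 - exp ((c - \<theta> * (2 * (a + c) / \<theta>) / 2) * real n) \<le> \<P>(\<omega> in evolver_space E.
      real (dist_at_iteration V E 2 ?s \<omega> j) \<le> (2 * (a + c) / \<theta>) * real n)"
      by (simp add: \<theta>_def c_def)
    moreover have "c - \<theta> * (2 * (a + c) / \<theta>) / 2 = - a"
      using theta_bounds by (simp add: \<theta>_def field_simps)
    moreover have "exp (- a * real n) \<le> real n powr (- a)"
    proof -
      have "ln (real n) \<le> real n" using ln_bound[of "real n"] that(2) by simp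
      with that(1,2) show ?thesis by (simp add: powr_def)
    qed
    ultimately show ?thesis by simp
  qed
  then have "\<forall>n\<ge>2. \<forall>(V :: 'v set) (E :: 'v set set) (M\<^sub>T :: nat \<Rightarrow> 'v) (M\<^sub>H :: nat \<Rightarrow> 'v).
       is_tree V E \<longrightarrow> card V = n \<longrightarrow> max_degree V E \<le> \<Delta> \<longrightarrow>
       bij_betw M\<^sub>T (labels V) V \<longrightarrow> M\<^sub>H \<in> labels V \<rightarrow> V \<longrightarrow>
       (\<forall>j > n + 2.
          \<P>(\<omega> in evolver_space E.
               real (dist_at_iteration V E 2 (init_state M\<^sub>T M\<^sub>H) \<omega> j) \<le> (2 * (a + c) / \<theta>) * real n)
            \<ge> 1 - real n powr (- a))" if "a > 0" for a
    using that by (intro allI impI) assumption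
  then show ?thesis
    by (intro exI[of _ "\<lambda>n. n + 2"]) blast
qed

end
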